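(* Let $\mathfrak{g}$ be an infinite dimensional Lie algebra over $\mathbb{C}$, and let $a\in\mathbb{C}$, where $a=1$ is required if $\mathfrak{g}$ is not abelian. Then the Lie conformal algebra $Vir\ltimes_a \mathrm{Cur}\,\mathfrak{g}$ does not have faithful finite modules.
   Context: Everything is over $\mathbb{C}$. A Lie conformal algebra $\mathcal{A}$ is a $\mathbb{C}[\partial]$-module with a $\mathbb{C}$-bilinear $\lambda$-bracket $[\cdot_\lambda\cdot]:\mathcal{A}\otimes\mathcal{A}\to\mathcal{A}[\lambda]$ such that $[\partial a_\lambda b]=-\lambda[a_\lambda b]$, $[a_\lambda\partial b]=(\partial+\lambda)[a_\lambda b]$, $[a_\lambda b]=-[b_{-\lambda-\partial}a]$, and $[a_\lambda[b_\mu c]]=[[a_\lambda b]_{\lambda+\mu}c]+[b_\mu[a_\lambda c]]$. An $\mathcal{A}$-module is a $\mathbb{C}[\partial]$-module $M$ with a $\mathbb{C}$-linear map $\mathcal{A}\otimes M\to M[\lambda]$, $a\otimes m\mapsto a_\lambda m$, such that $(\partial a)_\lambda m=-\lambda a_\lambda m$, $a_\lambda(\partial m)=(\partial+\lambda)a_\lambda m$, $a_\lambda(b_\mu m)=[a_\lambda b]_{\lambda+\mu}m+b_\mu(a_\lambda m)$. A module is finite if finitely generated over $\mathbb{C}[\partial]$, and faithful if no nonzero $a\in\mathcal{A}$ satisfies $a_\lambda m=0$ for all $m$. $Vir\ltimes_a\mathrm{Cur}\,\mathfrak{g}=\mathbb{C}[\partial]L\oplus(\mathbb{C}[\partial]\otimes\mathfrak{g})$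 is the free $\mathbb{C}[\partial]$-module with $[L_\lambda L]=(\partial+2\lambda)L$, $[L_\lambda x]=(\partial+a\lambda)x$, $[x_\lambda y]=[x,y]$ for $x,y\in\mathfrak{g}$. The convention is that $a=1$ when $\mathfrak{g}$ is not abelian, and $a\in\mathbb{C}$ is arbitrary when $\mathfrak{g}$ is abelian. *)

theory Defs
  imports Complex_Main "HOL-Computational_Algebra.Polynomial" "HOL-Library.Product_Plus"
begin

section \<open>Polynomials with coefficients in a module\<close>

text \<open>
  If \<open>M\<close> is an abelian group, \<open>M[\<lambda>]\<close> is the type \<open>'m poly\<close>, and \<open>M[\<lambda>,\<mu>]\<close> is \<open>'m poly poly\<close>, where the
  outer variable is \<open>\<mu>\<close> and the inner one is \<open>\<lambda>\<close>. Multiplication by the outermost variable is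
  \<open>pCons 0\<close>.

  \<open>poly_subst T e\<close> maps \<open>\<Sum>i. X^i m\<^sub>i\<close> to \<open>\<Sum>i. T^i (e m\<^sub>i)\<close>, i.e. it is the coefficient map \<open>e\<close> followed
  by the substitution of the operator \<open>T\<close> for the variable.
\<close>

definition poly_subst :: "('b \<Rightarrow> 'b) \<Rightarrow> ('a \<Rightarrow> 'b) \<Rightarrow> 'a::zero poly \<Rightarrow> 'b::comm_monoid_add" where
  "poly_subst T e p = (\<Sum>i\<le>degree p. (T ^^ i) (e (coeff p i)))"

definition mult_lam :: "'m::zero poly poly \<Rightarrow> 'm poly poly" where
  "mult_lam = map_poly (pCons 0)"

definition mult_mu :: "'m::zero poly poly \<Rightarrow> 'm poly poly" where
  "mult_mu = pCons 0"

text \<open>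
  Let \<open>act a m \<in> M[\<lambda>]\<close> be \<open>a\<^sub>\<lambda> m\<close>. The following are the elements
  \<open>a\<^sub>\<lambda> (b\<^sub>\<mu> m)\<close>, \<open>b\<^sub>\<mu> (a\<^sub>\<lambda> m)\<close> and \<open>c\<^bsub>\<lambda>+\<mu>\<^esub> m\<close>, for \<open>c \<in> A[\<lambda>]\<close>, of \<open>M[\<lambda>,\<mu>]\<close>.
\<close>

definition act_lam_mu :: "('a \<Rightarrow> 'm \<Rightarrow> 'm poly) \<Rightarrow> 'a \<Rightarrow> 'a \<Rightarrow> 'm::ab_group_add \<Rightarrow> 'm poly poly" where
  "act_lam_mu act a b m = map_poly (act a) (act b m)"

definition act_mu_lam :: "('a \<Rightarrow> 'm \<Rightarrow> 'm poly) \<Rightarrow> 'a \<Rightarrow> 'a \<Rightarrow> 'm::ab_group_add \<Rightarrow> 'm poly poly" where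
  "act_mu_lam act b a m = poly_subst mult_lam (\<lambda>v. map_poly (\<lambda>w. [:w:]) (act b v)) (act a m)"

definition act_lam_plus_mu ::
  "('a \<Rightarrow> 'm \<Rightarrow> 'm poly) \<Rightarrow> 'a::zero poly \<Rightarrow> 'm::ab_group_add \<Rightarrow> 'm poly poly" where
  "act_lam_plus_mu act c m =
     poly_subst mult_lam
       (\<lambda>d. poly_subst (\<lambda>h. mult_lam h + mult_mu h) (\<lambda>w. [:[:w:]:]) (act d m)) c"


section \<open>Lie algebras, Lie conformal algebras and conformal modules\<close>

locale lie_algebra = vector_space scale
  for scale :: "complex \<Rightarrow> 'g::ab_group_add \<Rightarrow> 'g" +
  fixes bracket :: "'g \<Rightarrow> 'g \<Rightarrow> 'g"
  assumes bracket_add_left: "bracket (x + y) z = bracket x z + bracket y z"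
    and bracket_add_right: "bracket x (y + z) = bracket x y + bracket x z"
    and bracket_scale_left: "bracket (scale c x) y = scale c (bracket x y)"
    and bracket_scale_right: "bracket x (scale c y) = scale c (bracket x y)"
    and bracket_self: "bracket x x = 0"
    and bracket_jacobi: "bracket x (bracket y z) = bracket (bracket x y) z + bracket y (bracket x z)"

definition lie_abelian :: "('g \<Rightarrow> 'g \<Rightarrow> 'g::zero) \<Rightarrow> bool" where
  "lie_abelian bracket \<longleftrightarrow> (\<forall>x y. bracket x y = 0)"

text \<open>
  A \<open>\<complex>[\<partial>]\<close>-module is a module over \<open>complex poly\<close>; \<open>\<partial>\<close> acts as \<open>scale [:0, 1:]\<close> and \<open>c \<in> \<complex>\<close> acts as
  \<open>scale [:c:]\<close>.
\<close>

locale lie_conformal_algebra = module scale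
  for scale :: "complex poly \<Rightarrow> 'a::ab_group_add \<Rightarrow> 'a" +
  fixes lbracket :: "'a \<Rightarrow> 'a \<Rightarrow> 'a poly"
  assumes lbracket_add_left: "lbracket (x + y) z = lbracket x z + lbracket y z"
    and lbracket_add_right: "lbracket x (y + z) = lbracket x y + lbracket x z"
    and lbracket_scale_left: "lbracket (scale [:c:] x) y = map_poly (scale [:c:]) (lbracket x y)"
    and lbracket_scale_right: "lbracket x (scale [:c:] y) = map_poly (scale [:c:]) (lbracket x y)"
    and lbracket_deriv_left: "lbracket (scale [:0, 1:] x) y = - pCons 0 (lbracket x y)"
    and lbracket_deriv_right:
      "lbracket x (scale [:0, 1:] y) = map_poly (scale [:0, 1:]) (lbracket x y) + pCons 0 (lbracket x y)"
    and lbracket_skew: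
      "lbracket x y =
         - poly_subst (\<lambda>h. - pCons 0 h - map_poly (scale [:0, 1:]) h) (\<lambda>v. [:v:]) (lbracket y x)"
    and lbracket_jacobi:
      "act_lam_mu lbracket x y z =
         act_lam_plus_mu lbracket (lbracket x y) z + act_mu_lam lbracket y x z"

locale conformal_module =
  lie_conformal_algebra scale lbracket + M: module mscale
  for scale :: "complex poly \<Rightarrow> 'a::ab_group_add \<Rightarrow> 'a"
    and lbracket :: "'a \<Rightarrow> 'a \<Rightarrow> 'a poly"
    and mscale :: "complex poly \<Rightarrow> 'm::ab_group_add \<Rightarrow> 'm" +
  fixes act :: "'a \<Rightarrow> 'm \<Rightarrow> 'm poly"
  assumes act_add_left: "act (x + y) m = act x m + act y m"
    and act_add_right: "act x (m + n) = act x m + act x n"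
    and act_scale_left: "act (scale [:c:] x) m = map_poly (mscale [:c:]) (act x m)"
    and act_scale_right: "act x (mscale [:c:] m) = map_poly (mscale [:c:]) (act x m)"
    and act_deriv_left: "act (scale [:0, 1:] x) m = - pCons 0 (act x m)"
    and act_deriv_right:
      "act x (mscale [:0, 1:] m) = map_poly (mscale [:0, 1:]) (act x m) + pCons 0 (act x m)"
    and act_jacobi:
      "act_lam_mu act x y m = act_lam_plus_mu act (lbracket x y) m + act_mu_lam act y x m"

definition finite_conformal :: "(complex poly \<Rightarrow> 'm::ab_group_add \<Rightarrow> 'm) \<Rightarrow> bool" where
  "finite_conformal mscale \<longleftrightarrow> (\<exists>S. finite S \<and> module.span mscale S = UNIV)"

definition faithful_conformal :: "('a::zero \<Rightarrow> 'm::zero \<Rightarrow> 'm poly) \<Rightarrow> bool" where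
  "faithful_conformal act \<longleftrightarrow> (\<forall>x. (\<forall>m. act x m = 0) \<longrightarrow> x = 0)"


section \<open>The Lie conformal algebra \<open>Vir \<ltimes>\<^sub>a Cur g\<close>\<close>

text \<open>
  The free \<open>\<complex>[\<partial>]\<close>-module \<open>\<complex>[\<partial>]L \<oplus> (\<complex>[\<partial>] \<otimes> g) = \<complex>[\<partial>] \<otimes> (\<complex>L \<oplus> g)\<close> is the type \<open>(complex \<times> 'g) poly\<close> of
  polynomials in \<open>\<partial>\<close> with coefficients in \<open>\<complex>L \<oplus> g\<close>; the pair \<open>(c, x)\<close> stands for \<open>cL + x\<close>.
\<close>

type_synonym 'g vir_cur = "(complex \<times> 'g) poly"

definition vir_L :: "'g::zero vir_cur" where
  "vir_L = [:(1, 0):]"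

definition cur :: "'g::zero \<Rightarrow> 'g vir_cur" where
  "cur x = [:(0, x):]"

definition vir_cur_scale ::
  "(complex \<Rightarrow> 'g::ab_group_add \<Rightarrow> 'g) \<Rightarrow> complex poly \<Rightarrow> 'g vir_cur \<Rightarrow> 'g vir_cur" where
  "vir_cur_scale scale f p =
     poly_subst (pCons 0) (\<lambda>c. map_poly (\<lambda>(d, x). (c * d, scale c x)) p) f"

text \<open>
  The bracket of \<open>cL + x\<close> and \<open>dL + y\<close>, as a polynomial in \<open>\<lambda>\<close> (outer) and \<open>\<partial>\<close> (inner). Skew-symmetry
  gives \<open>[x\<^sub>\<lambda> L] = ((a - 1)\<partial> + a\<lambda>) x\<close>.
\<close>

definition vir_cur_gen ::
  "(complex \<Rightarrow> 'g::ab_group_add \<Rightarrow> 'g) \<Rightarrow> ('g \<Rightarrow> 'g \<Rightarrow> 'g) \<Rightarrow> complex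
     \<Rightarrow> complex \<times> 'g \<Rightarrow> complex \<times> 'g \<Rightarrow> 'g vir_cur poly" where
  "vir_cur_gen scale bracket a = (\<lambda>(c, x) (d, y).
     [: [: (0, bracket x y), (c * d, scale c y + scale ((a - 1) * d) x) :],
        [: (2 * c * d, scale (a * c) y + scale (a * d) x) :] :])"

text \<open>The sesquilinear extension: \<open>[f(\<partial>)v\<^sub>\<lambda> g(\<partial>)w] = f(-\<lambda>) g(\<partial>+\<lambda>) [v\<^sub>\<lambda> w]\<close>.\<close>

definition vir_cur_bracket ::
  "(complex \<Rightarrow> 'g::ab_group_add \<Rightarrow> 'g) \<Rightarrow> ('g \<Rightarrow> 'g \<Rightarrow> 'g) \<Rightarrow> complex
     \<Rightarrow> 'g vir_cur \<Rightarrow> 'g vir_cur \<Rightarrow> 'g vir_cur poly" where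
  "vir_cur_bracket scale bracket a p q =
     poly_subst (\<lambda>h. - pCons 0 h)
       (\<lambda>v. poly_subst (\<lambda>h. map_poly (pCons 0) h + pCons 0 h) (vir_cur_gen scale bracket a v) q) p"


subsection \<open>\<open>Vir \<ltimes>\<^sub>a Cur g\<close> is a Lie conformal algebra\<close>

lemma poly_subst_0: "e 0 = 0 \<Longrightarrow> poly_subst T e 0 = 0"
  by (simp add: poly_subst_def)

lemma poly_subst_pCons:
  fixes T :: "'b::ab_group_add \<Rightarrow> 'b" and e :: "'a::zero \<Rightarrow> 'b"
  assumes "additive T" "e 0 = 0"
  shows "poly_subst T e (pCons c p) = e c + T (poly_subst T e p)"
proof (cases "p = 0")
  case True
  then show ?thesis
    using assms additive.zero[OF assms(1)] by (simp add: poly_subst_def)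
next
  case False
  have "poly_subst T e (pCons c p) = (\<Sum>i\<le>Suc (degree p). (T ^^ i) (e (coeff (pCons c p) i)))"
    using False by (simp add: poly_subst_def)
  also have "\<dots> = e c + (\<Sum>i\<le>degree p. T ((T ^^ i) (e (coeff p i))))"
    by (subst sum.atMost_Suc_shift) simp
  finally show ?thesis
    by (simp add: poly_subst_def additive.sum[OF assms(1)])
qed

lemma poly_subst_add:
  fixes T :: "'b::ab_group_add \<Rightarrow> 'b" and e :: "'a::ab_group_add \<Rightarrow> 'b"
  assumes "additive T" "additive e"
  shows "poly_subst T e (p + q) = poly_subst T e p + poly_subst T e q"
proof (induction p arbitrary: q)
  case 0
  then show ?case by (simp add: poly_subst_0 additive.zero[OF assms(2)])
next
  case (pCons c p)
  show ?case
    by (cases q) (simp add: poly_subst_pCons assms additive.zero[OF assms(2)] pCons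
        additive.add[OF assms(1)] additive.add[OF assms(2)])
qed

lemma additive_poly_subst:
  "additive (T :: 'b::ab_group_add \<Rightarrow> 'b) \<Longrightarrow> additive (e :: 'a::ab_group_add \<Rightarrow> 'b) \<Longrightarrow> additive (poly_subst T e)"
  by (simp add: additive_def poly_subst_add)

lemma poly_subst_comp:
  fixes T :: "'b::ab_group_add \<Rightarrow> 'b" and T' :: "'c::ab_group_add \<Rightarrow> 'c" and e :: "'a::zero \<Rightarrow> 'b"
  assumes "additive T" "additive T'" "e 0 = 0" "additive F" "\<And>x. F (T x) = T' (F x)"
  shows "poly_subst T' (\<lambda>v. F (e v)) p = F (poly_subst T e p)"
  by (induction p)
    (simp_all add: poly_subst_0 poly_subst_pCons assms additive.zero[OF assms(4)] additive.add[OF assms(4)])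

lemma poly_subst_map_poly:
  fixes T :: "'b::ab_group_add \<Rightarrow> 'b" and e :: "'a::zero \<Rightarrow> 'b"
  assumes "additive T" "e 0 = 0" "f 0 = 0"
  shows "poly_subst T e (map_poly f p) = poly_subst T (\<lambda>v. e (f v)) p"
  by (induction p)
    (simp_all add: poly_subst_0 poly_subst_pCons map_poly_pCons assms)

lemma poly_subst_add_fun:
  fixes T :: "'b::ab_group_add \<Rightarrow> 'b" and e :: "'a::zero \<Rightarrow> 'b"
  assumes "additive T" "e 0 = 0" "e' 0 = 0"
  shows "poly_subst T (\<lambda>v. e v + e' v) p = poly_subst T e p + poly_subst T e' p"
  by (induction p)
    (simp_all add: poly_subst_0 poly_subst_pCons assms additive.add[OF assms(1)])

lemma map_poly_add:
  fixes f :: "'a::ab_group_add \<Rightarrow> 'b::ab_group_add"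
  assumes "additive f"
  shows "map_poly f (p + q) = map_poly f p + map_poly f q"
  by (intro poly_eqI) (simp add: coeff_map_poly additive.zero[OF assms] additive.add[OF assms])

lemma additive_map_poly:
  "additive (f :: 'a::ab_group_add \<Rightarrow> 'b::ab_group_add) \<Longrightarrow> additive (map_poly f)"
  by (simp add: additive_def map_poly_add)

lemma additive_pCons: "additive (pCons (0 :: 'a::ab_group_add))"
  by (simp add: additive_def)

lemma additive_const: "additive (\<lambda>w :: 'a::ab_group_add. [:w:])"
  by (simp add: additive_def)

lemma additive_uminus_comp:
  "additive (f :: 'a::ab_group_add \<Rightarrow> 'b::ab_group_add) \<Longrightarrow> additive (\<lambda>h. - f h)"
  by (simp add: additive_def)

lemma additive_plus_comp:
  "additive (f :: 'a::ab_group_add \<Rightarrow> 'b::ab_group_add) \<Longrightarrow> additive g \<Longrightarrow> additive (\<lambda>h. f h + g h)"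
  by (simp add: additive_def)

lemma additive_minus_comp:
  "additive (f :: 'a::ab_group_add \<Rightarrow> 'b::ab_group_add) \<Longrightarrow> additive g \<Longrightarrow> additive (\<lambda>h. f h - g h)"
  by (simp add: additive_def)

lemma additive_comp:
  "additive (f :: 'b::ab_group_add \<Rightarrow> 'c::ab_group_add) \<Longrightarrow> additive (g :: 'a::ab_group_add \<Rightarrow> 'b)
    \<Longrightarrow> additive (\<lambda>h. f (g h))"
  by (simp add: additive_def)

lemma additive_mult_lam: "additive (mult_lam :: 'a::ab_group_add poly poly \<Rightarrow> _)"
  unfolding mult_lam_def by (intro additive_map_poly additive_pCons)

lemma additive_mult_mu: "additive (mult_mu :: 'a::ab_group_add poly poly \<Rightarrow> _)"
  unfolding mult_mu_def by (intro additive_pCons)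

lemmas additive_rules = additive_pCons additive_const additive_uminus_comp additive_plus_comp
  additive_minus_comp additive_mult_lam additive_mult_mu additive_map_poly additive_poly_subst

lemma poly_gen_induct [case_names const add shift]:
  fixes P :: "'a::ab_group_add poly \<Rightarrow> bool"
  assumes "\<And>v. P [:v:]" "\<And>p q. P p \<Longrightarrow> P q \<Longrightarrow> P (p + q)" "\<And>p. P p \<Longrightarrow> P (pCons 0 p)"
  shows "P p"
proof (induction p)
  case 0
  then show ?case using assms(1)[of 0] by simp
next
  case (pCons c p)
  then show ?case using assms(2)[OF assms(1)[of c] assms(3)[of p]] by simp
qed

context lie_algebra
begin

abbreviation "gen \<equiv> vir_cur_gen scale bracket"
abbreviation "br \<equiv> vir_cur_bracket scale bracket"
abbreviation "cs \<equiv> (\<lambda>c (d, x). (c * d, scale c x))"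

lemma bracket_0 [simp]: "bracket 0 x = 0" "bracket x 0 = 0"
  using bracket_add_left[of 0 0] bracket_add_right[of _ 0 0] by simp_all

lemma bracket_anti: "bracket x y = - bracket y x"
proof -
  have "bracket x y + bracket y x = 0"
    using bracket_self[of "x + y"] bracket_self[of x] bracket_self[of y]
    by (simp add: bracket_add_left bracket_add_right add.commute)
  then show ?thesis by (simp add: eq_neg_iff_add_eq_0)
qed

lemma additive_cs: "additive (cs c)"
  by (auto simp: additive_def distrib_left scale_right_distrib)

lemma additive_cs_left: "additive (\<lambda>c. map_poly (cs c) p)"
  by (auto simp: additive_def distrib_right scale_left_distrib intro!: poly_eqI 
      simp: coeff_map_poly zero_prod_def split: prod.splits)

lemma cs_0 [simp]: "cs c 0 = 0"
  using additive.zero[OF additive_cs] .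

lemma scale_const: "vir_cur_scale scale [:c:] = map_poly (cs c)"
  by (auto simp: vir_cur_scale_def poly_subst_def)

lemma vscale_0: "vir_cur_scale scale 0 p = 0"
  unfolding vir_cur_scale_def by (rule poly_subst_0, rule additive.zero[OF additive_cs_left])

lemma vscale_pCons:
  "vir_cur_scale scale (pCons c f) p = map_poly (cs c) p + pCons 0 (vir_cur_scale scale f p)"
  unfolding vir_cur_scale_def
  by (rule poly_subst_pCons) (rule additive_rules additive.zero[OF additive_cs_left])+

lemma scale_deriv: "vir_cur_scale scale [:0, 1:] = pCons 0"
proof
  fix p :: "'g vir_cur"
  have "map_poly (cs 1) p = p" by (rule map_poly_idI) auto
  moreover have "map_poly (cs 0) p = 0"
    by (rule additive.zero[OF additive_cs_left])
  ultimately show "vir_cur_scale scale [:0, 1:] p = pCons 0 p"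
    by (simp add: vscale_pCons vscale_0)
qed

lemma vscale_add_left: "vir_cur_scale scale (f + g) p = vir_cur_scale scale f p + vir_cur_scale scale g p"
  unfolding vir_cur_scale_def
  by (rule poly_subst_add) (rule additive_rules additive_cs_left)+

lemma vscale_add_right: "vir_cur_scale scale f (p + q) = vir_cur_scale scale f p + vir_cur_scale scale f q"
  by (induction f) (simp_all add: vscale_0 vscale_pCons map_poly_add[OF additive_cs])

lemma vscale_shift: "vir_cur_scale scale f (pCons 0 p) = pCons 0 (vir_cur_scale scale f p)"
  by (induction f) (simp_all add: vscale_0 vscale_pCons map_poly_pCons)

lemma cs_cs: "map_poly (cs c) (map_poly (cs d) p) = map_poly (cs (c * d)) p"
  by (rule poly_eqI) (simp add: coeff_map_poly split: prod.splits)

lemma vscale_smult: "vir_cur_scale scale (smult c f) p = map_poly (cs c) (vir_cur_scale scale f p)"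
  by (induction f) (simp_all add: vscale_0 vscale_pCons map_poly_add[OF additive_cs] map_poly_pCons cs_cs)

lemma module_vscale: "module (vir_cur_scale scale)"
proof
  show "vir_cur_scale scale a (x + y) = vir_cur_scale scale a x + vir_cur_scale scale a y" for a x y
    by (rule vscale_add_right)
  show "vir_cur_scale scale (a + b) x = vir_cur_scale scale a x + vir_cur_scale scale b x" for a b x
    by (rule vscale_add_left)
  have "map_poly (cs 0) x = 0" for x
    by (rule additive.zero[OF additive_cs_left])
  then show "vir_cur_scale scale a (vir_cur_scale scale b x) = vir_cur_scale scale (a * b) x" for a b x
    by (induction a) (simp_all add: vscale_0 vscale_pCons vscale_add_left vscale_smult)
  show "vir_cur_scale scale 1 x = x" for x
    unfolding one_pCons scale_const by (rule map_poly_idI) auto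
qed

lemma additive_gen_right: "additive (gen a v)"
  by (cases v) (auto simp: additive_def vir_cur_gen_def algebra_simps bracket_add_right)

lemma additive_gen_left: "additive (\<lambda>v. gen a v w)"
  by (cases w) (auto simp: additive_def vir_cur_gen_def algebra_simps bracket_add_left)

lemma gen_0 [simp]: "gen a v 0 = 0" "gen a 0 v = 0"
  using additive.zero[OF additive_gen_right] additive.zero[OF additive_gen_left] by auto

definition DL :: "'g vir_cur poly \<Rightarrow> 'g vir_cur poly" where
  "DL h = map_poly (pCons 0) h + pCons 0 h"

lemma DL_eq: "DL = (\<lambda>h. map_poly (pCons 0) h + pCons 0 h)"
  by (simp add: DL_def fun_eq_iff)

lemma additive_DL: "additive DL"
  unfolding DL_eq by (intro additive_rules)

lemma br_eq: "br a p q = poly_subst (\<lambda>h. - pCons 0 h) (\<lambda>v. poly_subst DL (gen a v) q) p"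
  by (simp add: vir_cur_bracket_def DL_eq)

lemma additive_inner: "additive (\<lambda>v. poly_subst DL (gen a v) q)"
proof (induction q)
  case 0
  then show ?case by (simp add: poly_subst_0 additive_def)
next
  case (pCons c q)
  show ?case
    by (simp add: poly_subst_pCons additive_DL)
      (intro additive_plus_comp additive_gen_left additive_comp[OF additive_DL] pCons)
qed

lemma br_add_left: "br a (p + p') q = br a p q + br a p' q"
  unfolding br_eq by (intro poly_subst_add additive_inner additive_rules)

lemma br_shift_left: "br a (pCons 0 p) q = - pCons 0 (br a p q)"
  unfolding br_eq
  by (subst poly_subst_pCons[OF additive_uminus_comp[OF additive_pCons]])
    (simp_all add: additive.zero[OF additive_inner])

lemma br_const_left: "br a [:v:] q = poly_subst DL (gen a v) q"
  by (simp add: br_eq poly_subst_def)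

lemma br_0_left [simp]: "br a 0 q = 0"
  using br_add_left[of a 0 0] by simp

lemma br_add_right: "br a p (q + q') = br a p q + br a p q'"
proof (induction p rule: poly_gen_induct)
  case (const v)
  then show ?case
    unfolding br_const_left by (intro poly_subst_add additive_gen_right additive_DL)
qed (simp_all add: br_add_left br_shift_left)

lemma br_0_right [simp]: "br a p 0 = 0"
  using br_add_right[of a p 0] by simp

lemma DL_shift: "DL (pCons 0 h) = pCons 0 (DL h)"
  by (simp add: DL_def map_poly_pCons)

lemma br_shift_right': "br a p (pCons 0 q) = DL (br a p q)"
proof (induction p rule: poly_gen_induct)
  case (const v)
  then show ?case
    unfolding br_const_left by (subst poly_subst_pCons) (simp_all add: additive_DL)
qed (simp_all add: br_add_left br_shift_left DL_shift additive.add[OF additive_DL] additive.minus[OF additive_DL])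

lemma br_shift_right: "br a p (pCons 0 q) = map_poly (pCons 0) (br a p q) + pCons 0 (br a p q)"
  by (simp add: br_shift_right' DL_def)

lemma br_const: "br a [:v:] [:w:] = gen a v w"
  unfolding br_const_left by (simp add: poly_subst_def)

lemma br_L_L: "br a vir_L vir_L = [:pCons 0 vir_L, vir_L + vir_L:]"
  by (simp add: vir_L_def br_const vir_cur_gen_def zero_prod_def)

lemma br_L_x: "br a vir_L (cur x) = [:pCons 0 (cur x), cur (scale a x):]"
  by (simp add: vir_L_def cur_def br_const vir_cur_gen_def zero_prod_def)

lemma br_x_y: "br a (cur x) (cur y) = [:cur (bracket x y):]"
  by (simp add: cur_def br_const vir_cur_gen_def zero_prod_def)


lemma br_scale_left: "br a (map_poly (cs c) p) q = map_poly (map_poly (cs c)) (br a p q)"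
proof (induction p rule: poly_gen_induct)
  case (const v)
  show ?case
  proof (induction q rule: poly_gen_induct)
    case (const w)
    show ?case
      by (cases v; cases w)
        (simp add: map_poly_pCons br_const vir_cur_gen_def bracket_scale_left scale_right_distrib;
         simp add: algebra_simps)
  next
    case (shift q)
    then show ?case
      by (simp add: br_shift_right map_poly_add additive_map_poly additive_cs map_poly_pCons poly_eq_iff coeff_map_poly coeff_pCons split: nat.splits)
  qed (simp add: br_add_right map_poly_add additive_map_poly additive_cs)
next
  case (shift p)
  then show ?case
    by (simp add: map_poly_pCons br_shift_left additive.minus additive_map_poly additive_cs)
qed (simp_all add: br_add_left map_poly_add additive_map_poly additive_cs)

lemma br_scale_right: "br a p (map_poly (cs c) q) = map_poly (map_poly (cs c)) (br a p q)"
proof (induction p rule: poly_gen_induct)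
  case (const v)
  show ?case
  proof (induction q rule: poly_gen_induct)
    case (const w)
    show ?case
      by (cases v; cases w)
        (simp add: map_poly_pCons br_const vir_cur_gen_def bracket_scale_right scale_right_distrib;
         simp add: algebra_simps)
  next
    case (shift q)
    then show ?case
      by (simp add: br_shift_right map_poly_add additive_map_poly additive_cs map_poly_pCons poly_eq_iff coeff_map_poly coeff_pCons split: nat.splits)
  qed (simp add: br_add_right map_poly_add additive_map_poly additive_cs)
next
  case (shift p)
  then show ?case
    by (simp add: map_poly_pCons br_shift_left additive.minus additive_map_poly additive_cs)
qed (simp_all add: br_add_left map_poly_add additive_map_poly additive_cs)

definition flip :: "'g vir_cur poly \<Rightarrow> 'g vir_cur poly" where
  "flip = poly_subst (\<lambda>h. - pCons 0 h - map_poly (pCons 0) h) (\<lambda>v. [:v:])"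

lemma additive_flip: "additive flip"
  unfolding flip_def by (intro additive_rules)

lemma flip_pCons: "flip (pCons v h) = [:v:] + (- pCons 0 (flip h) - map_poly (pCons 0) (flip h))"
  unfolding flip_def by (rule poly_subst_pCons) (intro additive_rules, simp)

lemma flip_0 [simp]: "flip 0 = 0"
  by (rule additive.zero[OF additive_flip])

lemma flip_deriv: "flip (map_poly (pCons 0) h) = map_poly (pCons 0) (flip h)"
  by (induction h)
    (simp_all add: map_poly_pCons flip_pCons additive.diff[OF additive_map_poly[OF additive_pCons]]
      map_poly_add[OF additive_pCons] additive.minus[OF additive_map_poly[OF additive_pCons]])

lemma br_skew: "br a p q = - flip (br a q p)"
proof (induction p rule: poly_gen_induct)
  case (const v)
  show ?case
  proof (induction q rule: poly_gen_induct)
    case (const w)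
    obtain c x d y where vw: "v = (c, x)" "w = (d, y)" by (cases v; cases w)
    show ?case
      using bracket_anti[of x y]
      by (simp add: vw map_poly_pCons br_const vir_cur_gen_def flip_pCons algebra_simps)
  next
    case (shift q)
    then show ?case
      by (simp add: br_shift_right br_shift_left additive.minus[OF additive_flip] flip_pCons
        additive.minus[OF additive_map_poly[OF additive_pCons]])
  qed (simp add: br_add_left br_add_right additive.add[OF additive_flip])
next
  case (shift p)
  then show ?case
    by (simp add: br_shift_right br_shift_left additive.add[OF additive_flip] flip_pCons flip_deriv)
qed (simp_all add: br_add_left br_add_right additive.add[OF additive_flip])

definition DD :: "'g vir_cur poly poly \<Rightarrow> 'g vir_cur poly poly" where
  "DD = map_poly (map_poly (pCons 0))"

lemma additive_DD: "additive DD"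
  unfolding DD_def by (intro additive_rules)

lemmas lin_ops =
  additive.add[OF additive_mult_lam] additive.minus[OF additive_mult_lam] additive.zero[OF additive_mult_lam]
  additive.add[OF additive_mult_mu] additive.minus[OF additive_mult_mu] additive.zero[OF additive_mult_mu]
  additive.add[OF additive_DD] additive.minus[OF additive_DD] additive.zero[OF additive_DD]

lemma ops_commute:
  "DD (mult_mu h) = mult_mu (DD h)" "DD (mult_lam h) = mult_lam (DD h)"
  "mult_lam (mult_mu h) = mult_mu (mult_lam h)"
  by (simp_all add: DD_def mult_mu_def mult_lam_def map_poly_pCons poly_eq_iff coeff_map_poly coeff_pCons split: nat.splits)

abbreviation "N1 a \<equiv> act_lam_mu (br a)"
abbreviation "N2 a \<equiv> act_mu_lam (br a)"
abbreviation "N3 a p q r \<equiv> act_lam_plus_mu (br a) (br a p q) r"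

lemma additive_br: "additive (br a p)" "additive (\<lambda>p. br a p q)"
  by (simp_all add: additive_def br_add_left br_add_right)

lemma N1_add:
  "N1 a (p + p') q r = N1 a p q r + N1 a p' q r"
  "N1 a p (q + q') r = N1 a p q r + N1 a p q' r"
  "N1 a p q (r + r') = N1 a p q r + N1 a p q r'"
  by (simp_all add: act_lam_mu_def poly_eq_iff coeff_map_poly br_add_left br_add_right)

lemma N1_shift:
  "N1 a (pCons 0 p) q r = - mult_lam (N1 a p q r)"
  "N1 a p (pCons 0 q) r = - mult_mu (N1 a p q r)"
  "N1 a p q (pCons 0 r) = DD (N1 a p q r) + mult_lam (N1 a p q r) + mult_mu (N1 a p q r)"
  by (simp_all add: act_lam_mu_def poly_eq_iff coeff_map_poly br_shift_left br_shift_right mult_lam_def mult_mu_def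
     DD_def br_add_right additive.minus[OF additive_br(1)] coeff_pCons split: nat.splits)

definition inj_mu :: "'g vir_cur poly \<Rightarrow> 'g vir_cur poly poly" where
  "inj_mu = map_poly (\<lambda>w. [:w:])"

lemma additive_inj_mu: "additive inj_mu"
  unfolding inj_mu_def by (intro additive_rules)

lemma inj_mu_0 [simp]: "inj_mu 0 = 0"
  by (rule additive.zero[OF additive_inj_mu])

lemma N2_eq: "N2 a q p r = poly_subst mult_lam (\<lambda>v. inj_mu (br a q v)) (br a p r)"
  by (simp add: act_mu_lam_def inj_mu_def)

lemma inj_mu_ops:
  "inj_mu (pCons 0 h) = mult_mu (inj_mu h)"
  "inj_mu (map_poly (pCons 0) h) = DD (inj_mu h)"
  by (simp_all add: inj_mu_def mult_mu_def DD_def poly_eq_iff coeff_map_poly coeff_pCons split: nat.splits)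

lemma subst_lam_shift: "e 0 = 0 \<Longrightarrow> poly_subst mult_lam e (pCons 0 h) = mult_lam (poly_subst mult_lam e h)"
  for e :: "'a::zero \<Rightarrow> 'g vir_cur poly poly"
  by (simp add: poly_subst_pCons additive_mult_lam)

lemma N2_add:
  "N2 a q (p + p') r = N2 a q p r + N2 a q p' r"
  "N2 a (q + q') p r = N2 a q p r + N2 a q' p r"
  "N2 a q p (r + r') = N2 a q p r + N2 a q p r'"
  unfolding N2_eq br_add_left br_add_right additive.add[OF additive_inj_mu]
  by (intro poly_subst_add poly_subst_add_fun additive_mult_lam additive_comp[OF additive_inj_mu] additive_br; simp)+

lemma additive_e2: "additive (\<lambda>v. inj_mu (br a q v))"
  by (intro additive_comp[OF additive_inj_mu] additive_br)

lemma N2_shift: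
  "N2 a q (pCons 0 p) r = - mult_lam (N2 a q p r)"
  "N2 a (pCons 0 q) p r = - mult_mu (N2 a q p r)"
  "N2 a q p (pCons 0 r) = DD (N2 a q p r) + mult_lam (N2 a q p r) + mult_mu (N2 a q p r)"
proof -
  show "N2 a q (pCons 0 p) r = - mult_lam (N2 a q p r)"
    by (simp add: N2_eq br_shift_left additive.minus[OF additive_poly_subst[OF additive_mult_lam additive_e2]]
       subst_lam_shift lin_ops)
  have "poly_subst mult_lam (\<lambda>v. - mult_mu (inj_mu (br a q v))) (br a p r)
     = - mult_mu (poly_subst mult_lam (\<lambda>v. inj_mu (br a q v)) (br a p r))"
    by (rule poly_subst_comp[where F = "\<lambda>h. - mult_mu h"])
      (simp_all add: additive_mult_lam additive_mult_mu additive_uminus_comp lin_ops ops_commute)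
  then show "N2 a (pCons 0 q) p r = - mult_mu (N2 a q p r)"
    by (simp add: N2_eq br_shift_left additive.minus[OF additive_inj_mu] inj_mu_ops lin_ops)
  have "poly_subst mult_lam (\<lambda>v. DD (inj_mu (br a q v)) + mult_mu (inj_mu (br a q v))) (br a p r)
     = DD (poly_subst mult_lam (\<lambda>v. inj_mu (br a q v)) (br a p r))
       + mult_mu (poly_subst mult_lam (\<lambda>v. inj_mu (br a q v)) (br a p r))"
    by (rule poly_subst_comp[where F = "\<lambda>h. DD h + mult_mu h"])
      (simp_all add: additive_mult_lam additive_mult_mu additive_DD additive_plus_comp lin_ops ops_commute)
  then show "N2 a q p (pCons 0 r) = DD (N2 a q p r) + mult_lam (N2 a q p r) + mult_mu (N2 a q p r)"
    by (simp add: N2_eq br_shift_right poly_subst_add[OF additive_mult_lam additive_e2] subst_lam_shift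
      poly_subst_map_poly[OF additive_mult_lam] additive.add[OF additive_inj_mu] inj_mu_ops)
qed

definition sub3 :: "'g vir_cur poly \<Rightarrow> 'g vir_cur poly poly" where
  "sub3 = poly_subst (\<lambda>h. mult_lam h + mult_mu h) (\<lambda>w. [:[:w:]:])"

lemma additive_sub3: "additive sub3"
  unfolding sub3_def by (intro additive_rules additive_comp[OF additive_const additive_const])

lemma sub3_0 [simp]: "sub3 0 = 0"
  by (rule additive.zero[OF additive_sub3])

lemma sub3_pCons: "sub3 (pCons v h) = [:[:v:]:] + (mult_lam (sub3 h) + mult_mu (sub3 h))"
  unfolding sub3_def by (rule poly_subst_pCons) (intro additive_rules, simp)

lemma sub3_deriv: "sub3 (map_poly (pCons 0) h) = DD (sub3 h)"
proof (induction h)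
  case (pCons v h)
  have "DD [:[:v:]:] = [:[:pCons 0 v:]:]" by (simp add: DD_def map_poly_pCons)
  with pCons show ?case by (simp add: map_poly_pCons sub3_pCons lin_ops ops_commute)
qed (simp add: lin_ops)

lemma N3_eq: "N3 a p q r = poly_subst mult_lam (\<lambda>d. sub3 (br a d r)) (br a p q)"
  by (simp add: act_lam_plus_mu_def sub3_def)

lemma additive_e3: "additive (\<lambda>d. sub3 (br a d r))"
  by (intro additive_comp[OF additive_sub3] additive_br)

lemma N3_add:
  "N3 a (p + p') q r = N3 a p q r + N3 a p' q r"
  "N3 a p (q + q') r = N3 a p q r + N3 a p q' r"
  "N3 a p q (r + r') = N3 a p q r + N3 a p q r'"
  unfolding N3_eq unfolding br_add_left br_add_right additive.add[OF additive_sub3]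
  by (intro poly_subst_add poly_subst_add_fun additive_mult_lam additive_e3; simp)+

lemma N3_shift:
  "N3 a (pCons 0 p) q r = - mult_lam (N3 a p q r)"
  "N3 a p (pCons 0 q) r = - mult_mu (N3 a p q r)"
  "N3 a p q (pCons 0 r) = DD (N3 a p q r) + mult_lam (N3 a p q r) + mult_mu (N3 a p q r)"
proof -
  show "N3 a (pCons 0 p) q r = - mult_lam (N3 a p q r)"
    unfolding N3_eq by (simp add: br_shift_left additive.minus[OF additive_poly_subst[OF additive_mult_lam additive_e3]]
       subst_lam_shift lin_ops)
  have "poly_subst mult_lam (\<lambda>d. - mult_lam (sub3 (br a d r)) - mult_mu (sub3 (br a d r))) (br a p q)
     = - mult_lam (poly_subst mult_lam (\<lambda>d. sub3 (br a d r)) (br a p q))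
       - mult_mu (poly_subst mult_lam (\<lambda>d. sub3 (br a d r)) (br a p q))"
    by (rule poly_subst_comp[where F = "\<lambda>h. - mult_lam h - mult_mu h"])
      (simp_all add: additive_mult_lam additive_mult_mu additive_minus_comp additive_uminus_comp
        lin_ops additive.diff[OF additive_mult_lam] ops_commute)
  then show "N3 a p (pCons 0 q) r = - mult_mu (N3 a p q r)"
    unfolding N3_eq by (simp add: br_shift_left br_shift_right poly_subst_add[OF additive_mult_lam additive_e3] subst_lam_shift
      poly_subst_map_poly[OF additive_mult_lam] additive.minus[OF additive_sub3] sub3_pCons lin_ops)
  have "poly_subst mult_lam (\<lambda>d. DD (sub3 (br a d r)) + mult_lam (sub3 (br a d r)) + mult_mu (sub3 (br a d r))) (br a p q)
     = DD (poly_subst mult_lam (\<lambda>d. sub3 (br a d r)) (br a p q))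
       + mult_lam (poly_subst mult_lam (\<lambda>d. sub3 (br a d r)) (br a p q))
       + mult_mu (poly_subst mult_lam (\<lambda>d. sub3 (br a d r)) (br a p q))"
    by (rule poly_subst_comp[where F = "\<lambda>h. DD h + mult_lam h + mult_mu h"])
      (simp_all add: additive_mult_lam additive_mult_mu additive_DD additive_plus_comp
        lin_ops ops_commute)
  then show "N3 a p q (pCons 0 r) = DD (N3 a p q r) + mult_lam (N3 a p q r) + mult_mu (N3 a p q r)"
    unfolding N3_eq by (simp add: br_shift_right additive.add[OF additive_sub3] sub3_pCons sub3_deriv algebra_simps)
qed

lemma br_jacobi_const:
  assumes "a = 1 \<or> (\<forall>x y. bracket x y = 0)"
  shows "N1 a [:u:] [:v:] [:w:] = N3 a [:u:] [:v:] [:w:] + N2 a [:v:] [:u:] [:w:]"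
proof -
  have br_pCons_left: "br a (pCons v p) q = br a [:v:] q - pCons 0 (br a p q)" for v p q
    using br_add_left[of a "[:v:]" "pCons 0 p" q] by (simp add: br_shift_left)
  have br_pCons_right: "br a p (pCons w q) = br a p [:w:] + DL (br a p q)" for w p q
    using br_add_right[of a p "[:w:]" "pCons 0 q"] by (simp add: br_shift_right')
  obtain c x d y e z where [simp]: "u = (c, x)" "v = (d, y)" "w = (e, z)"
    by (cases u; cases v; cases w)
  note calc = act_lam_mu_def br_const vir_cur_gen_def map_poly_pCons poly_subst_pCons
    poly_subst_0 additive_map_poly[OF additive_pCons] inj_mu_def sub3_pCons mult_lam_def mult_mu_def
    br_pCons_left[of _ "[:_:]"] br_pCons_right[of _ _ "[:_:]"] DL_def
  note lie = bracket_add_left bracket_add_right bracket_scale_left bracket_scale_right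
  have two: "scale (b * (b' * 2)) t = scale (b * b') t + scale (b * b') t" for b b' t
    by (simp flip: scale_left_distrib)
  have two': "scale (b * (b' * (b'' * 2))) t = scale (b * (b' * b'')) t + scale (b * (b' * b'')) t" for b b' b'' t
    using two[of "b * b'" b'' t] by (simp add: mult.assoc)
  from assms show ?thesis
  proof
    assume a: "a = 1"
    show ?thesis
      unfolding N3_eq N2_eq 
      by (simp add: calc, simp add: a lie bracket_jacobi[of x y z] bracket_anti[of y x] two zero_prod_def algebra_simps)
  next
    assume a: "\<forall>x y. bracket x y = 0"
    show ?thesis
      unfolding N3_eq N2_eq
      by (simp add: calc a, simp add: two two' zero_prod_def algebra_simps)
  qed
qed

lemma br_jacobi:
  assumes "a = 1 \<or> (\<forall>x y. bracket x y = 0)"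
  shows "N1 a p q r = N3 a p q r + N2 a q p r"
proof (induction p rule: poly_gen_induct)
  case (const u)
  show ?case
  proof (induction q rule: poly_gen_induct)
    case (const v)
    show ?case
    proof (induction r rule: poly_gen_induct)
      case (const w)
      show ?case by (rule br_jacobi_const[OF assms])
    next
      case (add r r')
      then show ?case by (simp only: N1_add N2_add N3_add algebra_simps)
    next
      case (shift r)
      then show ?case by (simp only: N1_shift N2_shift N3_shift lin_ops minus_add_distrib algebra_simps)
    qed
  next
    case (add q q')
    then show ?case by (simp only: N1_add N2_add N3_add algebra_simps)
  next
    case (shift q)
    then show ?case by (simp only: N1_shift N2_shift N3_shift lin_ops minus_add_distrib algebra_simps)
  qed
next
  case (add p p')
  then show ?case by (simp only: N1_add N2_add N3_add algebra_simps)
next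
  case (shift p)
  then show ?case by (simp only: N1_shift N2_shift N3_shift lin_ops minus_add_distrib algebra_simps)
qed

end

theorem lie_conformal_algebra_vir_cur:
  assumes "lie_algebra scale bracket" "\<not> lie_abelian bracket \<longrightarrow> a = 1"
  shows "lie_conformal_algebra (vir_cur_scale scale) (vir_cur_bracket scale bracket a)"
proof -
  interpret lie_algebra scale bracket by fact
  have a: "a = 1 \<or> (\<forall>x y. bracket x y = 0)"
    using assms(2) by (auto simp: lie_abelian_def)
  interpret V: module "vir_cur_scale scale" by (rule module_vscale)
  show ?thesis
  proof
    fix p q r c
    show "br a p q = - poly_subst (\<lambda>h. - pCons 0 h - map_poly (vir_cur_scale scale [:0, 1:]) h) (\<lambda>v. [:v:]) (br a q p)"
      unfolding scale_deriv by (rule br_skew[unfolded flip_def])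
    show "act_lam_mu (br a) p q r = act_lam_plus_mu (br a) (br a p q) r + act_mu_lam (br a) q p r"
      by (rule br_jacobi[OF a])
  qed (simp_all only: scale_deriv scale_const br_add_left br_add_right br_shift_left br_shift_right
      br_scale_left br_scale_right)
qed

end

theory Submission
  imports Defs "HOL-Computational_Algebra.Fundamental_Theorem_Algebra"
begin

text \<open>
  Write \<open>L\<^sub>\<lambda> = P + \<lambda>H + \<dots>\<close> for the action of \<open>L\<close> on a finite module \<open>M\<close>, and let \<open>u\<^sub>\<lambda> = \<Sum> \<lambda>\<^sup>k u\<^sub>k\<close> be the action
  of an element with \<open>[L\<^sub>\<lambda> u] = (\<partial> + c\<lambda>)u\<close>. The Jacobi identity gives \<open>[P, u\<^sub>k] = -u\<^bsub>k-1\<^esub>\<close>,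
  \<open>[H, u\<^sub>k] = (c - 1 - k)u\<^sub>k\<close> and \<open>[H, P] = P\<close>, and \<open>T = P - \<partial>\<close> commutes with \<open>\<partial>\<close>, \<open>P\<close>, \<open>H\<close> and all \<open>u\<^sub>k\<close>.
  Every \<open>u\<^sub>k\<close> maps \<open>M\<close> into the submodule \<open>K\<close> of elements annihilated by some nonzero \<open>R \<in> \<complex>[T]\<close>. As \<open>K\<close> is
  finitely generated, one \<open>R\<close> annihilates all of \<open>K\<close>, so \<open>u\<^sub>k R(T) = 0\<close>; moreover \<open>K/PK\<close> and
  \<open>M/(PM + R(T)M)\<close> are finite dimensional, because \<open>T \<equiv> -\<partial>\<close> modulo \<open>P\<close>. Comparing eigenvalues of \<open>H\<close>, a
  \<open>u\<close> whose components \<open>u\<^sub>k\<close> with \<open>k \<le> B\<close> map \<open>M\<close> into \<open>P\<^bsup>B-k\<^esup>K\<close> maps \<open>M\<close> into \<open>\<Inter>\<^sub>j P\<^sup>j K = 0\<close>, if \<open>B\<close> is large.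
  These are finitely many linear conditions of finite codimension, so on a faithful module the elements \<open>u\<close>
  form a finite dimensional space. For \<open>c = a\<close> this space contains a copy of \<open>g\<close>.
\<close>

section \<open>Ideals and finitely generated modules over a polynomial ring\<close>

text \<open>A nonzero element of least degree divides all others, because remainders stay in
  \<open>I\<close>.\<close>

lemma poly_ideal_principal:
  fixes I :: "'k::field poly set"
  assumes "I \<noteq> {}" and add: "\<And>p q. p \<in> I \<Longrightarrow> q \<in> I \<Longrightarrow> p + q \<in> I"
    and mult: "\<And>p q. q \<in> I \<Longrightarrow> p * q \<in> I"
  obtains d where "d \<in> I" "\<And>p. p \<in> I \<Longrightarrow> d dvd p"
proof (cases "I \<subseteq> {0}")
  case True
  with assms(1) show ?thesis by (intro that[of 0]) auto
next
  case False
  then obtain p0 where p0: "p0 \<in> I \<and> p0 \<noteq> 0" by blast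
  define d where "d = arg_min degree (\<lambda>p. p \<in> I \<and> p \<noteq> 0)"
  have d: "d \<in> I" "d \<noteq> 0"
    using arg_min_natI[of "\<lambda>p. p \<in> I \<and> p \<noteq> 0", OF p0, of degree] by (auto simp: d_def)
  have min: "degree d \<le> degree p" if "p \<in> I" "p \<noteq> 0" for p
    unfolding d_def by (rule arg_min_nat_le) (use that in simp)
  show ?thesis
  proof (rule that[OF d(1)])
    fix p assume p: "p \<in> I"
    have "p mod d = p + (- (p div d)) * d"
      by (simp add: minus_div_mult_eq_mod [symmetric])
    then have "p mod d \<in> I" using add[OF p mult[OF d(1)]] by metis
    with min degree_mod_less'[OF d(2), of p] show "d dvd p"
      by (auto simp: dvd_eq_mod_eq_0 dest: leD)
  qed
qed

text \<open>As \<open>T\<close> is -\<partial> modulo \<open>P\<close>, an annihilator R(T) turns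
  into R(-\<partial>), which has to remain a nonzero polynomial.\<close>

lemma pcompose_uminus_eq_0: "p \<circ>\<^sub>p [:0, -1:] = 0 \<longleftrightarrow> p = 0" for p :: "'k::field poly"
  using pcompose_eq_0[of p "[:0, -1:]"] by auto

text \<open>A root of a generator would be a common root of \<open>f\<close> and \<open>g\<close>,
  and a complex polynomial without roots is a nonzero constant. This converts disjointness of
  spectra into membership of 1.\<close>

lemma complex_poly_ideal_unit:
  fixes I :: "complex poly set"
  assumes add: "\<And>p q. p \<in> I \<Longrightarrow> q \<in> I \<Longrightarrow> p + q \<in> I"
    and mult: "\<And>p q. q \<in> I \<Longrightarrow> p * q \<in> I"
    and "f \<in> I" "g \<in> I" and no_root: "\<And>z. poly f z = 0 \<Longrightarrow> poly g z = 0 \<Longrightarrow> False"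
  shows "1 \<in> I"
proof -
  obtain d where d: "d \<in> I" "\<And>p. p \<in> I \<Longrightarrow> d dvd p"
    using poly_ideal_principal[of I] assms by (metis empty_iff)
  have "poly d z \<noteq> 0" for z
    using no_root[of z] d(2)[OF assms(3)] d(2)[OF assms(4)] by (auto elim!: dvdE)
  then have "constant (poly d)"
    using fundamental_theorem_of_algebra by blast
  then obtain c where c: "d = [:c:]"
    by (metis constant_degree degree_eq_zeroE)
  with \<open>poly d 0 \<noteq> 0\<close> have "1 = [:1 / c:] * d" by (simp add: one_pCons)
  then show ?thesis using mult[OF d(1)] by metis
qed

text \<open>Induction on the generators. The coefficients at the new generator \<open>v\<close> of
  elements of \<open>N\<close> form an ideal; an element of \<open>N\<close> lifting its generator
  \<open>d\<close>, together with generators of \<open>N \<inter> span S\<close>, generates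
  \<open>N\<close>.\<close>

lemma finitely_generated_submodule:
  fixes scale :: "'k::field poly \<Rightarrow> 'm::ab_group_add \<Rightarrow> 'm"
  assumes "module scale" "finite S" "module.subspace scale N" "N \<subseteq> module.span scale S"
  shows "\<exists>F. finite F \<and> F \<subseteq> N \<and> N = module.span scale F"
  using assms(2-)
proof (induction S arbitrary: N rule: finite_induct)
  case empty
  interpret module scale by fact
  show ?case using empty subspace_0 by (intro exI[of _ "{}"]) auto
next
  case (insert v S)
  interpret module scale by fact
  note N = insert.prems(1)
  obtain F' where F': "finite F'" "F' \<subseteq> N \<inter> span S" "N \<inter> span S = span F'"
    using insert.IH[of "N \<inter> span S"] subspace_inter[OF N subspace_span] by blast
  define I where "I = {r. \<exists>s\<in>span S. scale r v + s \<in> N}"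
  obtain d where d: "d \<in> I" "\<And>p. p \<in> I \<Longrightarrow> d dvd p"
  proof (rule poly_ideal_principal[of I])
    have "0 \<in> I" unfolding I_def using span_zero subspace_0[OF N] by force
    then show "I \<noteq> {}" by blast
    show "p + q \<in> I" if "p \<in> I" "q \<in> I" for p q
    proof -
      from that obtain s t where "s \<in> span S" "scale p v + s \<in> N" "t \<in> span S" "scale q v + t \<in> N"
        by (auto simp: I_def)
      then show ?thesis
        unfolding I_def using subspace_add[OF N, of "scale p v + s" "scale q v + t"] span_add[of s S t]
        by (auto simp: scale_left_distrib algebra_simps intro!: bexI[of _ "s + t"])
    qed
    show "p * q \<in> I" if "q \<in> I" for p q
    proof -
      from that obtain s where "s \<in> span S" "scale q v + s \<in> N" by (auto simp: I_def)
      then show ?thesis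
        unfolding I_def using subspace_scale[OF N, of "scale q v + s" p] span_scale[of s S p]
        by (auto simp: scale_right_distrib intro!: bexI[of _ "scale p s"])
    qed
  qed blast
  from d(1) obtain s0 where s0: "s0 \<in> span S" "scale d v + s0 \<in> N" by (auto simp: I_def)
  let ?n = "scale d v + s0"
  have "n \<in> span (insert ?n F')" if n: "n \<in> N" for n
  proof -
    from n insert.prems(2) have "n \<in> span (insert v S)" by blast
    then obtain k where k: "n - scale k v \<in> span S"
      unfolding span_breakdown_eq by blast
    have "k \<in> I"
      unfolding I_def using n by (auto intro!: bexI[OF _ k])
    then obtain e where e: "k = e * d" using d(2) by (metis dvd_def mult.commute)
    have "n - scale e ?n = (n - scale k v) - scale e s0"
      by (simp add: e scale_right_distrib)
    then have "n - scale e ?n \<in> span S"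
      using span_diff[OF k span_scale[OF s0(1)], of e] by metis
    moreover have "n - scale e ?n \<in> N"
      using N n s0(2) by (intro subspace_diff subspace_scale)
    ultimately show ?thesis
      using F'(3) by (auto simp: span_breakdown_eq)
  qed
  moreover have "span (insert ?n F') \<subseteq> N"
    using F'(2) s0(2) by (intro span_minimal N) auto
  ultimately show ?case
    using F' s0 by (intro exI[of _ "insert ?n F'"]) auto
qed

text \<open>The union of the chain is a submodule, and its finitely many generators already lie in
  one member.\<close>

lemma ascending_chain_stabilizes:
  fixes scale :: "'k::field poly \<Rightarrow> 'm::ab_group_add \<Rightarrow> 'm"
  assumes "module scale" "finite S" "module.span scale S = UNIV"
    and sub: "\<And>i. module.subspace scale (N i)" and mono: "\<And>i j. i \<le> j \<Longrightarrow> N i \<subseteq> N (j::nat)"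
  obtains n where "\<And>i. N i \<subseteq> N n"
proof -
  interpret module scale by fact
  have "subspace (\<Union>i. N i)"
  proof (rule subspaceI)
    show "0 \<in> (\<Union>i. N i)" using subspace_0[OF sub] by blast
    show "x + y \<in> (\<Union>i. N i)" if xy: "x \<in> (\<Union>i. N i)" "y \<in> (\<Union>i. N i)" for x y
    proof -
      from xy obtain i j where "x \<in> N i" "y \<in> N j" by blast
      then have "x \<in> N (max i j)" "y \<in> N (max i j)"
        using mono[of i "max i j"] mono[of j "max i j"] by auto
      then show ?thesis using subspace_add[OF sub] by blast
    qed
    show "scale c x \<in> (\<Union>i. N i)" if "x \<in> (\<Union>i. N i)" for c x
      using that subspace_scale[OF sub] by blast
  qed
  then obtain F where F: "finite F" "F \<subseteq> (\<Union>i. N i)" "(\<Union>i. N i) = span F"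
    using finitely_generated_submodule[OF assms(1,2), of "\<Union>i. N i"] assms(3) by auto
  from F(1,2) have "\<exists>n. F \<subseteq> N n"
  proof (induction F rule: finite_induct)
    case (insert v F)
    then obtain n i where "F \<subseteq> N n" "v \<in> N i" by blast
    then have "insert v F \<subseteq> N (max n i)"
      using mono[of n "max n i"] mono[of i "max n i"] by auto
    then show ?case ..
  qed simp
  then obtain n where "F \<subseteq> N n" ..
  then have "span F \<subseteq> N n" by (intro span_minimal sub)
  with F(3) show ?thesis by (intro that[of n]) blast
qed

text \<open>The coefficients are attached to indices and not to vectors, since \<open>f\<close> need
  not be injective.\<close>

lemma (in module) span_image_atMost:
  assumes "x \<in> span (f ` {..n::nat})"
  shows "\<exists>c. x = (\<Sum>i\<le>n. scale (c i) (f i))"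
  using assms
proof (induction n arbitrary: x)
  case 0
  then show ?case by (auto simp: span_breakdown_eq)
next
  case (Suc n)
  then obtain k where "x - scale k (f (Suc n)) \<in> span (f ` {..n})"
    by (auto simp: atMost_Suc span_breakdown_eq)
  then obtain c where c: "x - scale k (f (Suc n)) = (\<Sum>i\<le>n. scale (c i) (f i))"
    using Suc.IH by blast
  then have "x = (\<Sum>i\<le>Suc n. scale ((c(Suc n := k)) i) (f i))"
    by (simp add: algebra_simps)
  then show ?case by blast
qed


section \<open>Subspaces of finite codimension\<close>

text \<open>For a subspace \<open>W\<close> of \<open>A\<close> this is finiteness of dim A/W,
  expressed without a quotient space.\<close>

definition finite_codim :: "('k::field \<Rightarrow> 'v::ab_group_add \<Rightarrow> 'v) \<Rightarrow> 'v set \<Rightarrow> 'v set \<Rightarrow> bool" where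
  "finite_codim scale A W \<longleftrightarrow> (\<exists>F. finite F \<and> F \<subseteq> A \<and> A \<subseteq> module.span scale (F \<union> W))"

lemma (in vector_space) finite_codim_refl: "finite_codim scale A A"
  unfolding finite_codim_def by (intro exI[of _ "{}"]) (auto intro: span_base)

lemma (in vector_space) finite_codim_trans:
  assumes "finite_codim scale A B" "finite_codim scale B C" "B \<subseteq> A"
  shows "finite_codim scale A C"
proof -
  from assms obtain F G where F: "finite F" "F \<subseteq> A" "A \<subseteq> span (F \<union> B)"
    and G: "finite G" "G \<subseteq> B" "B \<subseteq> span (G \<union> C)"
    by (auto simp: finite_codim_def)
  have "B \<subseteq> span (F \<union> G \<union> C)"
    using G(3) span_mono[of "G \<union> C" "F \<union> G \<union> C"] by blast
  then have "span (F \<union> B) \<subseteq> span (F \<union> G \<union> C)"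
    by (intro span_minimal) (auto intro: span_base)
  with F G assms(3) show ?thesis
    unfolding finite_codim_def by (intro exI[of _ "F \<union> G"]) blast
qed

lemma (in vector_space) finite_codim_image:
  assumes lin: "Vector_Spaces.linear scale scale f" and "finite_codim scale A W"
  shows "finite_codim scale (f ` A) (f ` W)"
proof -
  interpret f: Vector_Spaces.linear scale scale f by fact
  obtain F where "finite F" "F \<subseteq> A" "A \<subseteq> span (F \<union> W)"
    using assms(2) by (auto simp: finite_codim_def)
  then have "finite (f ` F)" "f ` F \<subseteq> f ` A" "f ` A \<subseteq> span (f ` F \<union> f ` W)"
    using f.span_image[of "F \<union> W"] by (auto simp: image_Un)
  then show ?thesis unfolding finite_codim_def by blast
qed

text \<open>Induction on \<open>F\<close>: enlarging \<open>W\<close> by one vector \<open>v\<close>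
  enlarges the preimage by at most one dimension, spanned by any \<open>y\<close> in
  \<open>D\<close> with \<open>f y\<close> in kv + W, k nonzero. The vectors of \<open>F\<close> may
  lie outside the image of \<open>D\<close>.\<close>

lemma (in vector_space_pair) finite_codim_vimage:
  assumes lin: "Vector_Spaces.linear s1 s2 f" and D: "vs1.subspace D" and "vs2.subspace W"
    and "finite F" "f ` D \<subseteq> vs2.span (F \<union> W)"
  shows "finite_codim s1 D (D \<inter> f -` W)"
  using assms(4,3,5)
proof (induction F arbitrary: W rule: finite_induct)
  case empty
  then have "D \<inter> f -` W = D" using vs2.span_eq_iff[THEN iffD2, OF empty(1)] by auto
  then show ?case using vs1.finite_codim_refl by simp
next
  case (insert v F)
  interpret f: Vector_Spaces.linear s1 s2 f by fact
  define W' where "W' = vs2.span (insert v W)"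
  have W': "vs2.subspace W'" unfolding W'_def by simp
  have "W \<subseteq> W'" "v \<in> W'" unfolding W'_def by (auto intro: vs2.span_base)
  then have "vs2.span (insert v F \<union> W) \<subseteq> vs2.span (F \<union> W')"
    by (intro vs2.span_mono) auto
  with insert have "finite_codim s1 D (D \<inter> f -` W')" by (intro insert.IH W') auto
  moreover have "finite_codim s1 (D \<inter> f -` W') (D \<inter> f -` W)"
  proof (cases "\<exists>y\<in>D. \<exists>k. k \<noteq> 0 \<and> f y - s2 k v \<in> W")
    case True
    then obtain y k where y: "y \<in> D" "k \<noteq> 0" "f y - s2 k v \<in> W" by blast
    have "x \<in> vs1.span (insert y (D \<inter> f -` W))" if x: "x \<in> D" "f x \<in> W'" for x
    proof -
      from x(2) obtain l where l: "f x - s2 l v \<in> W"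
        by (auto simp: W'_def vs2.span_breakdown_eq vs2.span_eq_iff[THEN iffD2, OF insert.prems(1)])
      have "f (x - s1 (l / k) y) = (f x - s2 l v) - s2 (l / k) (f y - s2 k v)"
        using y(2) by (simp add: f.diff f.scale vs2.scale_right_diff_distrib)
      also have "\<dots> \<in> W"
        by (rule vs2.subspace_diff[OF insert.prems(1) l vs2.subspace_scale[OF insert.prems(1) y(3)]])
      finally have "x - s1 (l / k) y \<in> D \<inter> f -` W"
        using D x y by (auto intro: vs1.subspace_diff vs1.subspace_scale)
      then show ?thesis
        by (auto simp: vs1.span_breakdown_eq intro: vs1.span_base)
    qed
    moreover have "y \<in> f -` W'"
      using y by (auto simp: W'_def vs2.span_breakdown_eq intro: vs2.span_base)
    ultimately show ?thesis
      unfolding finite_codim_def using y by (intro exI[of _ "{y}"]) auto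
  next
    case False
    have "f x \<in> W" if "x \<in> D" "f x \<in> W'" for x
    proof -
      from that(2) obtain l where l: "f x - s2 l v \<in> W"
        by (auto simp: W'_def vs2.span_breakdown_eq vs2.span_eq_iff[THEN iffD2, OF insert.prems(1)])
      with False that(1) show ?thesis by (cases "l = 0") auto
    qed
    then have "D \<inter> f -` W' = D \<inter> f -` W" using \<open>W \<subseteq> W'\<close> by auto
    then show ?thesis using vs1.finite_codim_refl by simp
  qed
  ultimately show ?case by (rule vs1.finite_codim_trans) auto
qed

text \<open>The conditions are imposed one at a time, each inside the subspace \<open>?E\<close> cut
  out by the earlier ones.\<close>

lemma (in vector_space_pair) finite_codim_INT_vimage:
  assumes "finite I" "vs1.subspace D"
    and "\<And>i. i \<in> I \<Longrightarrow> Vector_Spaces.linear s1 s2 (f i)" "\<And>i. i \<in> I \<Longrightarrow> vs2.subspace (W i)"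
    and "\<And>i. i \<in> I \<Longrightarrow> f i ` D \<subseteq> A i" "\<And>i. i \<in> I \<Longrightarrow> finite_codim s2 (A i) (W i)"
  shows "finite_codim s1 D {x \<in> D. \<forall>i\<in>I. f i x \<in> W i}"
  using assms(1,3-)
proof (induction I rule: finite_induct)
  case empty
  then show ?case using vs1.finite_codim_refl by simp
next
  case (insert i I)
  let ?E = "{x \<in> D. \<forall>i\<in>I. f i x \<in> W i}"
  have lin: "Vector_Spaces.linear s1 s2 (f j)" if "j \<in> insert i I" for j using insert.prems(1) that .
  have E: "vs1.subspace ?E"
  proof (rule vs1.subspaceI)
    fix x y c assume x: "x \<in> ?E"
    show "s1 c x \<in> ?E" using x insert.prems(2) lin
      by (auto simp: linear_scale intro!: vs1.subspace_scale assms(2) vs2.subspace_scale)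
    assume "y \<in> ?E"
    then show "x + y \<in> ?E" using x insert.prems(2) lin
      by (auto simp: linear_add intro!: vs1.subspace_add assms(2) vs2.subspace_add)
  qed (use insert.prems(2) lin assms(2) in \<open>auto simp: vs1.subspace_0 vs2.subspace_0 linear_0\<close>)
  obtain F where "finite F" "A i \<subseteq> vs2.span (F \<union> W i)"
    using insert.prems(4)[of i] by (auto simp: finite_codim_def)
  moreover have "f i ` ?E \<subseteq> A i" using insert.prems(3)[of i] by auto
  ultimately have "finite_codim s1 ?E (?E \<inter> f i -` W i)"
    using insert.prems E by (intro finite_codim_vimage) auto
  moreover have "finite_codim s1 D ?E" using insert by auto
  moreover have "?E \<inter> f i -` W i = {x \<in> D. \<forall>i\<in>insert i I. f i x \<in> W i}" by auto
  ultimately show ?case using vs1.finite_codim_trans[of D ?E] by auto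
qed


section \<open>Polynomials in a linear operator\<close>

text \<open>This is p(f) v: a coefficient c becomes the vector \<open>scale c v\<close>, and
  \<open>f\<close> is substituted for the variable.\<close>

definition poly_op ::
  "('k::field \<Rightarrow> 'v::ab_group_add \<Rightarrow> 'v) \<Rightarrow> ('v \<Rightarrow> 'v) \<Rightarrow> 'k poly \<Rightarrow> 'v \<Rightarrow> 'v" where
  "poly_op scale f p v = poly_subst f (\<lambda>c. scale c v) p"

context vector_space
begin

lemma poly_op_0 [simp]: "poly_op scale f 0 v = 0"
  by (simp add: poly_op_def poly_subst_0)

lemma linear_simps:
  assumes "Vector_Spaces.linear scale scale f"
  shows "f (v + w) = f v + f w" "f (scale c v) = scale c (f v)" "f 0 = 0"
  using assms unfolding Vector_Spaces.linear_iff by (blast, blast, metis scale_zero_left)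

lemma additive_linear: "Vector_Spaces.linear scale scale f \<Longrightarrow> additive f"
  by (simp add: additive_def linear_simps)

lemma poly_op_pCons:
  assumes "Vector_Spaces.linear scale scale f"
  shows "poly_op scale f (pCons c p) v = scale c v + f (poly_op scale f p v)"
  by (simp add: poly_op_def poly_subst_pCons additive_linear assms)

lemma poly_op_const:
  assumes "Vector_Spaces.linear scale scale f"
  shows "poly_op scale f [:c:] v = scale c v"
  by (simp add: poly_op_pCons linear_simps assms)

lemma poly_op_1:
  assumes "Vector_Spaces.linear scale scale f"
  shows "poly_op scale f 1 v = v"
  by (simp add: one_pCons poly_op_const assms)

lemma poly_op_add:
  assumes "Vector_Spaces.linear scale scale f"
  shows "poly_op scale f (p + q) v = poly_op scale f p v + poly_op scale f q v"
  unfolding poly_op_def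
  by (rule poly_subst_add[OF additive_linear[OF assms]]) (simp add: additive_def scale_left_distrib)

lemma poly_op_smult:
  assumes "Vector_Spaces.linear scale scale f"
  shows "poly_op scale f (smult c p) v = scale c (poly_op scale f p v)"
  by (induction p) (simp_all add: poly_op_pCons linear_simps assms scale_right_distrib)

lemma poly_op_mult:
  assumes "Vector_Spaces.linear scale scale f"
  shows "poly_op scale f (p * q) v = poly_op scale f p (poly_op scale f q v)"
  by (induction p) (simp_all add: poly_op_pCons poly_op_add poly_op_smult linear_simps assms)

lemma linear_poly_op:
  assumes "Vector_Spaces.linear scale scale f"
  shows "Vector_Spaces.linear scale scale (poly_op scale f p)"
proof unfold_locales
  show "poly_op scale f p (v + w) = poly_op scale f p v + poly_op scale f p w" for v w
    by (induction p) (simp_all add: poly_op_pCons linear_simps assms scale_right_distrib)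
  show "poly_op scale f p (scale c v) = scale c (poly_op scale f p v)" for c v
    by (induction p) (simp_all add: poly_op_pCons linear_simps assms scale_right_distrib scale_left_commute)
qed

lemma poly_op_closed:
  assumes "Vector_Spaces.linear scale scale f"
    and "subspace A" "\<And>v. v \<in> A \<Longrightarrow> f v \<in> A" "v \<in> A"
  shows "poly_op scale f p v \<in> A"
  using assms
  by (induction p) (auto simp: poly_op_pCons intro: subspace_0 subspace_add subspace_scale)

lemma poly_op_pcompose:
  assumes "Vector_Spaces.linear scale scale f"
  shows "poly_op scale f (p \<circ>\<^sub>p q) v = poly_op scale (poly_op scale f q) p v"
  by (induction p)
    (simp_all add: pcompose_pCons poly_op_add poly_op_const poly_op_mult poly_op_pCons linear_poly_op linear_simps
      assms)

lemma poly_op_intertwine: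
  assumes "Vector_Spaces.linear scale scale f" "Vector_Spaces.linear scale scale f'"
    and "Vector_Spaces.linear scale scale g" "\<And>v. f' (g v) = g (f v)"
  shows "poly_op scale f' p (g v) = g (poly_op scale f p v)"
proof -
  interpret g: Vector_Spaces.linear scale scale g by fact
  show ?thesis
    by (induction p) (simp_all add: poly_op_pCons assms g.zero g.add g.scale)
qed

text \<open>The hypothesis reads f g = g (f + b), hence p(f) g = g p(f + b). With \<open>H\<close>
  for \<open>f\<close> this moves polynomials in \<open>H\<close> past u_k and P^j.\<close>

lemma poly_op_shift:
  assumes "Vector_Spaces.linear scale scale f" "Vector_Spaces.linear scale scale g"
    and "\<And>v. f (g v) = g (f v) + scale b (g v)"
  shows "poly_op scale f p (g v) = g (poly_op scale f (p \<circ>\<^sub>p [:b, 1:]) v)"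
proof -
  interpret g: Vector_Spaces.linear scale scale g by fact
  interpret f: Vector_Spaces.linear scale scale f by fact
  show ?thesis
    unfolding poly_op_pcompose[OF assms(1)]
    by (rule poly_op_intertwine[OF linear_poly_op[OF assms(1)] assms(1,2)])
      (simp add: assms(1,3) poly_op_pCons f.zero g.add g.scale add.commute)
qed

text \<open>The polynomial kills the endomorphism that \<open>f\<close> induces on the finite
  dimensional quotient A/W. It is a product of annihilators of single vectors of a finite spanning
  set.\<close>

lemma finite_codim_annihilator:
  assumes lin: "Vector_Spaces.linear scale scale f"
    and A: "subspace A" "\<And>v. v \<in> A \<Longrightarrow> f v \<in> A"
    and W: "subspace W" "\<And>v. v \<in> W \<Longrightarrow> f v \<in> W" and "finite_codim scale A W"
  obtains p where "p \<noteq> 0" "\<And>v. v \<in> A \<Longrightarrow> poly_op scale f p v \<in> W"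
proof -
  interpret P: vector_space "smult :: 'a \<Rightarrow> 'a poly \<Rightarrow> 'a poly"
    by unfold_locales (simp_all add: smult_add_right smult_add_left)
  interpret pair: vector_space_pair "smult :: 'a \<Rightarrow> 'a poly \<Rightarrow> 'a poly" scale ..
  obtain F where F: "finite F" "F \<subseteq> A" "A \<subseteq> span (F \<union> W)"
    using assms(6) by (auto simp: finite_codim_def)
  \<comment> \<open>If p -> p(f) v were injective modulo \<open>W\<close>, the polynomial ring would
    be finite dimensional, against its unbounded degrees.\<close>
  have ex: "\<exists>p. p \<noteq> 0 \<and> poly_op scale f p v \<in> W" if v: "v \<in> A" for v
  proof (rule ccontr)
    assume "\<nexists>p. p \<noteq> 0 \<and> poly_op scale f p v \<in> W"
    then have sub: "UNIV \<inter> (\<lambda>p. poly_op scale f p v) -` W \<subseteq> {0}" by auto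
    have "finite_codim smult UNIV (UNIV \<inter> (\<lambda>p. poly_op scale f p v) -` W)"
    proof (rule pair.finite_codim_vimage[OF _ _ W(1) F(1)])
      show "Vector_Spaces.linear smult scale (\<lambda>p. poly_op scale f p v)"
        by unfold_locales (simp_all add: poly_op_add poly_op_smult lin)
      show "range (\<lambda>p. poly_op scale f p v) \<subseteq> span (F \<union> W)"
        using F(3) poly_op_closed[OF lin A v] by blast
    qed simp
    then obtain G where G: "finite G" "UNIV \<subseteq> P.span (G \<union> (UNIV \<inter> (\<lambda>p. poly_op scale f p v) -` W))"
      by (auto simp: finite_codim_def)
    define n where "n = Max (insert 0 (degree ` G))"
    have "degree p \<le> n" if "p \<in> G" for p
      unfolding n_def using G(1) that by (intro Max_ge) auto
    then have "P.span (G \<union> (UNIV \<inter> (\<lambda>p. poly_op scale f p v) -` W)) \<subseteq> {p. degree p \<le> n}"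
      using sub
      by (intro P.span_minimal P.subspaceI) (auto intro: degree_add_le le_trans[OF degree_smult_le])
    with G(2) have "monom 1 (Suc n) \<in> {p :: 'a poly. degree p \<le> n}" by blast
    then show False by (simp add: degree_monom_eq)
  qed
  have "\<exists>p. p \<noteq> 0 \<and> (\<forall>v\<in>F. poly_op scale f p v \<in> W)"
    using F(1,2)
  proof (induction F rule: finite_induct)
    case empty
    then show ?case by (intro exI[of _ 1]) simp
  next
    case (insert v F)
    then obtain p q where "p \<noteq> 0" "\<forall>v\<in>F. poly_op scale f p v \<in> W" "q \<noteq> 0" "poly_op scale f q v \<in> W"
      using ex[of v] by auto
    moreover from this have "poly_op scale f (p * q) v \<in> W"
      by (simp add: poly_op_mult[OF lin] poly_op_closed[OF lin W])
    moreover from calculation have "\<forall>v\<in>F. poly_op scale f (p * q) v \<in> W"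
      by (subst mult.commute) (simp add: poly_op_mult[OF lin] poly_op_closed[OF lin W])
    ultimately show ?case
      by (intro exI[of _ "p * q"]) simp
  qed
  then obtain p where p: "p \<noteq> 0" "\<And>v. v \<in> F \<Longrightarrow> poly_op scale f p v \<in> W" by blast
  interpret p: Vector_Spaces.linear scale scale "poly_op scale f p" by (rule linear_poly_op[OF lin])
  have "span (F \<union> W) \<subseteq> poly_op scale f p -` W"
    using p poly_op_closed[OF lin W] W(1) by (intro span_minimal p.subspace_vimage) auto
  with F(3) p show ?thesis by (intro that[of p]) auto
qed

end


text \<open>Linear factors of \<open>R\<close> are removed one by one; the first nonzero vector
  R'(f) v so reached is killed by the factor f - \<alpha> just removed. The hypothesis
  \<open>root\<close> says that the field is algebraically closed.\<close>

lemma (in vector_space) annihilated_eigenvector: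
  fixes f :: "'b \<Rightarrow> 'b" and R :: "'a poly"
  assumes root: "\<And>p :: 'a poly. degree p > 0 \<Longrightarrow> \<exists>z. poly p z = 0"
    and lin: "Vector_Spaces.linear scale scale f"
    and A: "subspace A" "\<And>v. v \<in> A \<Longrightarrow> f v \<in> A"
    and "R \<noteq> 0" "poly_op scale f R v = 0" "v \<in> A" "v \<noteq> 0"
  obtains \<alpha> w where "w \<in> A" "w \<noteq> 0" "f w = scale \<alpha> w"
proof -
  have "\<exists>w \<alpha>. w \<in> A \<and> w \<noteq> 0 \<and> f w = scale \<alpha> w"
    using assms(5,6)
  proof (induction "degree R" arbitrary: R)
    case 0
    then obtain c where "R = [:c:]" "c \<noteq> 0" by (metis degree_eq_zeroE pCons_0_0)
    then show ?case using 0 assms(8) by (simp add: poly_op_const lin)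
  next
    case (Suc n)
    then obtain \<alpha> R' where R': "R = [:- \<alpha>, 1:] * R'"
      using root[of R] by (metis poly_eq_0_iff_dvd dvd_def zero_less_Suc)
    have "R' \<noteq> 0" using R' Suc.prems by auto
    have "degree R = Suc (degree R')"
      using \<open>R' \<noteq> 0\<close> unfolding R' by (subst degree_mult_eq) auto
    let ?w = "poly_op scale f R' v"
    show ?case
    proof (cases "?w = 0")
      case True
      then show ?thesis using Suc.hyps \<open>R' \<noteq> 0\<close> \<open>degree R = Suc (degree R')\<close> by simp
    next
      case False
      have "f ?w + scale (- \<alpha>) ?w = 0"
        using Suc.prems(2)
        by (simp add: R' poly_op_mult lin poly_op_pCons linear_simps add.commute del: mult_pCons_left)
      then show ?thesis
        using False poly_op_closed[OF lin A assms(7)] by (intro exI[of _ ?w] exI[of _ \<alpha>]) simp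
    qed
  qed
  then show ?thesis using that by blast
qed

lemma (in vector_space) poly_op_sum_monom:
  assumes "Vector_Spaces.linear scale scale f"
  shows "poly_op scale f (\<Sum>i\<le>n. monom (c i) i) v = (\<Sum>i\<le>(n::nat). scale (c i) ((f ^^ i) v))"
proof -
  have "poly_op scale f (monom a i) v = scale a ((f ^^ i) v)" for a i
    by (induction i) (simp_all add: monom_0 monom_Suc poly_op_const poly_op_pCons linear_simps assms)
  then show ?thesis by (induction n) (simp_all add: poly_op_add assms)
qed

section \<open>Virasoro primary elements acting on a conformal module\<close>

context conformal_module
begin

section \<open>Complex scalars and the coefficients of the \<lambda>-action\<close>

abbreviation cscale :: "complex \<Rightarrow> 'a \<Rightarrow> 'a" where "cscale c \<equiv> scale [:c:]"
abbreviation cmscale :: "complex \<Rightarrow> 'm \<Rightarrow> 'm" where "cmscale c \<equiv> mscale [:c:]"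
abbreviation dee :: "'m \<Rightarrow> 'm" where "dee \<equiv> mscale [:0, 1:]"

sublocale C: vector_space cscale
  by unfold_locales
    (simp_all add: scale_right_distrib mult.commute flip: scale_left_distrib one_pCons)

sublocale MC: vector_space cmscale
  by unfold_locales
    (simp_all add: M.scale_right_distrib mult.commute flip: M.scale_left_distrib one_pCons)

lemma mscale_pCons: "mscale (pCons c p) m = cmscale c m + dee (mscale p m)"
  by (simp flip: M.scale_left_distrib)

lemma linear_mscale: "Vector_Spaces.linear cmscale cmscale (mscale p)"
  by unfold_locales (simp_all add: M.scale_right_distrib)

text \<open>Plain coefficients of \<lambda>^k, without the factorials of the usual k-th
  products.\<close>

definition coeff_act :: "'a \<Rightarrow> nat \<Rightarrow> 'm \<Rightarrow> 'm" where
  "coeff_act u k m = coeff (act u m) k"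

lemma act_0 [simp]: "act u 0 = 0" "act 0 m = 0"
  using act_add_right[of u 0 0] act_add_left[of 0 0 m] by simp_all

lemma linear_coeff_act: "Vector_Spaces.linear cmscale cmscale (coeff_act u k)"
  by unfold_locales (simp_all add: coeff_act_def act_add_right act_scale_right coeff_map_poly)

lemma linear_coeff_act_left: "Vector_Spaces.linear cscale cmscale (\<lambda>u. coeff_act u k m)"
  by unfold_locales (simp_all add: coeff_act_def act_add_left act_scale_left coeff_map_poly)

lemma coeff_act_dee:
  "coeff_act u 0 (dee m) = dee (coeff_act u 0 m)"
  "coeff_act u (Suc k) (dee m) = dee (coeff_act u (Suc k) m) + coeff_act u k m"
  by (simp_all add: coeff_act_def act_deriv_right coeff_map_poly)

text \<open>Sesquilinearity sends p(\<partial>) m to p(\<partial>+\<lambda>) u_\<lambda> m. When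
  u_\<lambda> m has no power above \<lambda>^n, the power \<lambda>^(n+s) arises only from the
  coefficient of \<partial>^s, and no \<partial> remains. Allowing \<open>s\<close> above the degree
  lets several polynomials share one \<open>s\<close>.\<close>

lemma coeff_act_mscale_top:
  assumes "degree p \<le> s" "\<And>i. i > n \<Longrightarrow> coeff_act u i m = 0"
  shows "coeff_act u (n + s) (mscale p m) = cmscale (coeff p s) (coeff_act u n m)"
  using assms(1)
proof (induction p arbitrary: s)
  case 0
  then show ?case by (simp add: coeff_act_def)
next
  case (pCons c p)
  interpret a: Vector_Spaces.linear cmscale cmscale "coeff_act u k" for k
    by (rule linear_coeff_act)
  show ?case
  proof (cases s)
    case 0
    then have "p = 0" using pCons.prems by (cases "p = 0") auto
    then show ?thesis using 0 by (simp add: a.scale)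
  next
    case (Suc s')
    have "degree p \<le> s'" using pCons.prems Suc by (cases "p = 0") auto
    then show ?thesis
      using pCons.IH[of s'] pCons.IH[of s] Suc assms(2)[of "Suc (n + s')"]
      by (simp add: mscale_pCons[of c p] a.add a.scale coeff_act_dee coeff_eq_0
          del: M.scale_scale)
  qed
qed

text \<open>The leading coefficient in \<lambda> of 0 = p(\<partial>+\<lambda>) u_\<lambda> m is a
  nonzero multiple of that of u_\<lambda> m.\<close>

lemma act_torsion:
  assumes "mscale p m = 0" "p \<noteq> 0"
  shows "act u m = 0"
proof -
  let ?n = "degree (act u m)"
  have "cmscale (coeff p (degree p)) (coeff_act u ?n m) = 0"
    using coeff_act_mscale_top[of p "degree p" ?n u m] assms(1)
    by (simp add: coeff_act_def coeff_eq_0)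
  then show ?thesis using assms(2) by (simp add: coeff_act_def)
qed

section \<open>Commutation relations extracted from the Jacobi identity\<close>

lemma coeff_mult_lam: "coeff (mult_lam h) k = pCons 0 (coeff h k)" for h :: "'m poly poly"
  by (simp add: mult_lam_def coeff_map_poly)

lemma coeff_act_mu_lam:
  "coeff (coeff (act_mu_lam act u v m) k) i = coeff_act u k (coeff_act v i m)"
proof -
  have "coeff (coeff (poly_subst mult_lam (\<lambda>v. map_poly (\<lambda>w. [:w:]) (act u v)) p) k) i
      = coeff (act u (coeff p i)) k" for p
    by (induction p arbitrary: i)
      (auto simp: poly_subst_0 poly_subst_pCons additive_mult_lam coeff_mult_lam coeff_map_poly
        coeff_pCons split: nat.splits)
  then show ?thesis by (simp add: act_mu_lam_def coeff_act_def)
qed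

lemma coeff_act_lam_mu:
  "coeff (coeff (act_lam_mu act u v m) k) i = coeff_act u i (coeff_act v k m)"
  by (simp add: act_lam_mu_def coeff_act_def coeff_map_poly)

definition at_lam_plus_mu :: "'m poly \<Rightarrow> 'm poly poly" where
  "at_lam_plus_mu = poly_subst (\<lambda>h. mult_lam h + mult_mu h) (\<lambda>w. [:[:w:]:])"

lemma at_lam_plus_mu_pCons:
  "at_lam_plus_mu (pCons w h) = [:[:w:]:] + (mult_lam (at_lam_plus_mu h) + mult_mu (at_lam_plus_mu h))"
  unfolding at_lam_plus_mu_def by (rule poly_subst_pCons) (intro additive_rules, simp)

lemma at_lam_plus_mu_0 [simp]: "at_lam_plus_mu 0 = 0"
  by (simp add: at_lam_plus_mu_def poly_subst_0)

lemma coeff_at_lam_plus_mu_0: "coeff (coeff (at_lam_plus_mu h) k) 0 = coeff h k"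
  by (induction h arbitrary: k)
    (auto simp: at_lam_plus_mu_pCons coeff_mult_lam mult_mu_def coeff_pCons split: nat.splits)

text \<open>The factor is the coefficient of \<lambda>\<mu>^k in (\<lambda>+\<mu>)^(k+1).\<close>

lemma coeff_at_lam_plus_mu_1:
  "coeff (coeff (at_lam_plus_mu h) k) (Suc 0) = cmscale (of_nat (Suc k)) (coeff h (Suc k))"
proof (induction h arbitrary: k)
  case (pCons w h)
  have "cmscale (1 + (1 + of_nat j)) v = v + cmscale (1 + of_nat j) v" for j v
    using MC.scale_left_distrib[of 1 "1 + of_nat j" v] by (simp flip: one_pCons)
  with pCons show ?case
    by (auto simp: at_lam_plus_mu_pCons coeff_mult_lam mult_mu_def coeff_pCons
        coeff_at_lam_plus_mu_0 simp flip: one_pCons split: nat.splits)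
qed simp

lemma act_lam_plus_mu_linear:
  "act_lam_plus_mu act [:d0, d1:] m
     = at_lam_plus_mu (act d0 m) + mult_lam (at_lam_plus_mu (act d1 m))"
  by (simp add: act_lam_plus_mu_def poly_subst_pCons poly_subst_0 additive_mult_lam
      additive.zero[OF additive_mult_lam] flip: at_lam_plus_mu_def)

definition primary :: "'a \<Rightarrow> complex \<Rightarrow> 'a \<Rightarrow> bool" where
  "primary L c u \<longleftrightarrow> lbracket L u = [:scale [:0, 1:] u, cscale c u:]"

text \<open>The coefficient of \<lambda>^0 \<mu>^k in the Jacobi identity, where \<partial>u acts as
  -(\<lambda>+\<mu>)u. The last term is u_(k-1) m, which \<open>pCons 0\<close> makes zero at k =
  0.\<close>

lemma primary_commute_0:
  assumes "primary L c u"
  shows "coeff_act L 0 (coeff_act u k m) = coeff_act u k (coeff_act L 0 m) - coeff (pCons 0 (act u m)) k"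
  using arg_cong[OF act_jacobi[of L u m], of "\<lambda>h. coeff (coeff h k) 0"] assms
  by (simp add: primary_def coeff_act_lam_mu coeff_act_mu_lam act_lam_plus_mu_linear act_deriv_left
      act_scale_left coeff_at_lam_plus_mu_0 coeff_mult_lam coeff_pCons split: nat.splits)

text \<open>The coefficient of \<lambda>\<mu>^k: c\<lambda>u contributes c, and -(\<lambda>+\<mu>)u
  contributes -(k+1).\<close>

lemma primary_commute_1:
  assumes "primary L c u"
  shows "coeff_act L 1 (coeff_act u k m)
    = coeff_act u k (coeff_act L 1 m) + cmscale (c - 1 - of_nat k) (coeff_act u k m)"
  using arg_cong[OF act_jacobi[of L u m], of "\<lambda>h. coeff (coeff h k) 1"] assms
  by (simp add: primary_def coeff_act_lam_mu coeff_act_mu_lam act_lam_plus_mu_linear act_deriv_left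
      act_scale_left coeff_at_lam_plus_mu_0 coeff_at_lam_plus_mu_1 coeff_mult_lam coeff_map_poly,
      simp add: coeff_act_def diff_diff_eq flip: MC.scale_left_diff_distrib)

text \<open>Division by \<open>p\<close>: modulo \<open>W\<close> only remainders applied to the
  generators survive.\<close>

lemma finite_codim_of_torsion:
  assumes "finite S" "A = M.span S" "M.subspace W" "p \<noteq> 0" "\<And>v. v \<in> A \<Longrightarrow> mscale p v \<in> W"
  shows "finite_codim cmscale A W"
proof -
  define F where "F = (\<lambda>(i, v). mscale (monom 1 i) v) ` ({..degree p} \<times> S)"
  have F: "finite F" "F \<subseteq> A"
    using assms(1) unfolding F_def assms(2) by (auto intro: M.span_scale M.span_base)
  have low: "mscale r v \<in> MC.span (F \<union> W)" if "v \<in> S" "degree r \<le> degree p" for r v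
  proof -
    have "mscale r v = mscale (\<Sum>i\<le>degree r. monom (coeff r i) i) v"
      by (simp add: poly_as_sum_of_monoms)
    also have "\<dots> = (\<Sum>i\<le>degree r. cmscale (coeff r i) (mscale (monom 1 i) v))"
      by (simp add: M.scale_sum_left smult_monom)
    also have "\<dots> \<in> MC.span (F \<union> W)"
      using that by (intro MC.span_sum MC.span_scale MC.span_base) (force simp: F_def)
    finally show ?thesis .
  qed
  have "v \<in> MC.span (F \<union> W)" if "v \<in> M.span S" for v
    using that
  proof (induction rule: M.span_induct_alt)
    case base
    show ?case by (rule MC.span_zero)
  next
    case (step q v y)
    have "mscale q v = mscale (q div p * p + q mod p) v" by simp
    also have "\<dots> = mscale (q div p) (mscale p v) + mscale (q mod p) v"
      by (simp only: M.scale_left_distrib M.scale_scale)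
    finally have "mscale q v = \<dots>" .
    moreover have "mscale (q div p) (mscale p v) \<in> MC.span (F \<union> W)"
      using step(1) assms(2) by (intro MC.span_base UnI2 M.subspace_scale[OF assms(3) assms(5)])
        (auto intro: M.span_base)
    moreover have "degree (q mod p) \<le> degree p"
      using degree_mod_less[OF assms(4), of q] by auto
    ultimately show ?case
      using low step by (auto intro!: MC.span_add)
  qed
  with F assms(2) show ?thesis unfolding finite_codim_def by blast
qed

end


text \<open>The Virasoro bracket of \<open>L\<close> with itself is phrased as being primary of
  weight 2, so that \<open>L\<close> obeys the same commutation lemmas as the other primary
  elements. The ambient Lie conformal algebra stays arbitrary.\<close>

locale finite_virasoro_module = conformal_module scale lbracket mscale act
  for scale :: "complex poly \<Rightarrow> 'a::ab_group_add \<Rightarrow> 'a" and lbracket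
    and mscale :: "complex poly \<Rightarrow> 'm::ab_group_add \<Rightarrow> 'm" and act +
  fixes L :: 'a
  assumes primary_L: "primary L 2 L" and finite_module: "finite_conformal mscale"
begin

section \<open>The operators P, H, T and their commutators\<close>

abbreviation "P \<equiv> coeff_act L 0"
abbreviation "H \<equiv> coeff_act L (Suc 0)"

definition T :: "'m \<Rightarrow> 'm" where "T m = P m - dee m"

interpretation P: Vector_Spaces.linear cmscale cmscale P by (rule linear_coeff_act)
interpretation H: Vector_Spaces.linear cmscale cmscale H by (rule linear_coeff_act)
interpretation dee: Vector_Spaces.linear cmscale cmscale dee by (rule linear_mscale)
interpretation u: Vector_Spaces.linear cmscale cmscale "coeff_act u k" for u k by (rule linear_coeff_act)

lemma linear_T: "Vector_Spaces.linear cmscale cmscale T"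
  by unfold_locales (simp_all add: T_def P.add P.scale dee.add dee.scale MC.scale_right_diff_distrib
    del: M.scale_scale)

interpretation T: Vector_Spaces.linear cmscale cmscale T by (rule linear_T)

lemma H_P: "H (P m) = P (H m) + P m"
  using primary_commute_1[OF primary_L, of 0 m] by simp

lemma T_dee: "T (dee m) = dee (T m)"
  by (simp only: T_def coeff_act_dee dee.diff)

lemma H_T: "H (T m) = T (H m)"
  by (simp only: T_def H.diff H_P coeff_act_dee) (simp del: M.scale_scale)

lemma T_P: "T (P m) = P (T m)"
  by (simp only: T_def P.diff coeff_act_dee)

lemma P_coeff_act:
  assumes "primary L c u"
  shows "P (coeff_act u 0 m) = coeff_act u 0 (P m)"
    and "coeff_act u (Suc k) (P m) = P (coeff_act u (Suc k) m) + coeff_act u k m"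
  using primary_commute_0[OF assms, of _ m] by (simp_all add: coeff_act_def)

lemma H_coeff_act:
  assumes "primary L c u"
  shows "H (coeff_act u k m) = coeff_act u k (H m) + cmscale (c - 1 - of_nat k) (coeff_act u k m)"
  using primary_commute_1[OF assms] by simp

text \<open>\<open>P\<close> and \<partial> have the same commutator -u_(k-1) with u_k (zero for k =
  0), so their difference commutes with u_k.\<close>

lemma T_coeff_act:
  assumes "primary L c u"
  shows "T (coeff_act u k m) = coeff_act u k (T m)"
  using P_coeff_act[OF assms]
  by (cases k) (simp_all add: T_def u.diff coeff_act_dee del: M.scale_scale)

lemma T_mscale: "T (mscale p m) = mscale p (T m)"
proof (induction p)
  case (pCons c p)
  then show ?case
    by (simp add: mscale_pCons[of c p] T.add T.scale T_dee del: M.scale_scale)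
qed (simp add: T.zero)

abbreviation TT :: "complex poly \<Rightarrow> 'm \<Rightarrow> 'm" where "TT \<equiv> poly_op cmscale T"

interpretation TT: Vector_Spaces.linear cmscale cmscale "TT R" for R
  by (rule MC.linear_poly_op[OF linear_T])

lemma TT_commute:
  assumes "Vector_Spaces.linear cmscale cmscale g" "\<And>v. T (g v) = g (T v)"
  shows "TT R (g v) = g (TT R v)"
  using MC.poly_op_intertwine[OF linear_T linear_T assms(1)] assms(2) by blast

lemmas TT_commutes =
  TT_commute[OF linear_coeff_act T_P] TT_commute[OF linear_coeff_act H_T[symmetric]]
  TT_commute[OF linear_mscale T_mscale] TT_commute[OF linear_T refl]
  TT_commute[OF linear_coeff_act T_coeff_act]

section \<open>The T-torsion submodule K\<close>

definition K :: "'m set" where "K = {v. \<exists>R. R \<noteq> 0 \<and> TT R v = 0}"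

lemma K_closed:
  assumes "Vector_Spaces.linear cmscale cmscale g" "\<And>v. T (g v) = g (T v)" "v \<in> K"
  shows "g v \<in> K"
proof -
  interpret g: Vector_Spaces.linear cmscale cmscale g by fact
  show ?thesis using assms(3) TT_commute[OF assms(1,2)] g.zero by (auto simp: K_def)
qed

lemma K_closeds:
  "v \<in> K \<Longrightarrow> P v \<in> K" "v \<in> K \<Longrightarrow> H v \<in> K" "v \<in> K \<Longrightarrow> mscale p v \<in> K" "v \<in> K \<Longrightarrow> T v \<in> K"
  by (erule K_closed[rotated 2];
      rule linear_coeff_act linear_mscale linear_T T_P H_T[symmetric] T_mscale refl)+

lemma subspace_K: "M.subspace K"
proof (rule M.subspaceI)
  show "0 \<in> K" unfolding K_def using TT.zero by (auto intro: exI[of _ 1])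
  show "v + w \<in> K" if "v \<in> K" "w \<in> K" for v w
  proof -
    from that obtain R Q where R: "R \<noteq> 0" "TT R v = 0" and Q: "Q \<noteq> 0" "TT Q w = 0"
      by (auto simp: K_def)
    have "TT (R * Q) w = 0" using Q by (simp add: MC.poly_op_mult linear_T TT.zero)
    moreover have "TT (R * Q) v = 0"
      using R by (subst mult.commute) (simp add: MC.poly_op_mult linear_T TT.zero)
    ultimately show ?thesis using R Q by (auto simp: K_def TT.add intro!: exI[of _ "R * Q"])
  qed
qed (rule K_closeds)

lemma finitely_generated:
  obtains S where "finite S" "M.span S = UNIV"
  using finite_module by (auto simp: finite_conformal_def)

lemma finitely_generated_K:
  obtains F where "finite F" "F \<subseteq> K" "K = M.span F"
proof -
  obtain S where S: "finite S" "M.span S = UNIV" by (rule finitely_generated)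
  have "\<exists>F. finite F \<and> F \<subseteq> K \<and> K = M.span F"
    by (rule finitely_generated_submodule[OF M.module_axioms S(1) subspace_K]) (simp add: S(2))
  then show ?thesis using that by blast
qed

text \<open>A product of annihilators of the generators of \<open>K\<close> suffices, because the
  kernel of R(T) is a submodule over C[\<partial>].\<close>

lemma K_annihilator:
  obtains R where "R \<noteq> 0" "\<And>v. v \<in> K \<Longrightarrow> TT R v = 0"
proof -
  obtain F where F: "finite F" "F \<subseteq> K" "K = M.span F" by (rule finitely_generated_K)
  have "\<exists>R. R \<noteq> 0 \<and> (\<forall>v\<in>F. TT R v = 0)"
    using F(1,2)
  proof (induction F rule: finite_induct)
    case empty
    then show ?case by (intro exI[of _ 1]) simp
  next
    case (insert v F)
    then obtain Q R where R: "R \<noteq> 0" "TT R v = 0" and Q: "Q \<noteq> 0" "\<forall>v\<in>F. TT Q v = 0"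
      by (auto simp: K_def)
    have "\<forall>w\<in>F. TT (R * Q) w = 0" using Q by (simp add: MC.poly_op_mult linear_T TT.zero)
    moreover have "TT (R * Q) v = 0"
      using R by (subst mult.commute) (simp add: MC.poly_op_mult linear_T TT.zero)
    ultimately show ?case using R Q by (intro exI[of _ "R * Q"]) auto
  qed
  then obtain R where R: "R \<noteq> 0" "\<And>v. v \<in> F \<Longrightarrow> TT R v = 0" by blast
  have "M.subspace {v. TT R v = 0}"
    by (rule M.subspaceI) (simp_all add: TT.zero TT.add TT_commutes)
  then have "M.span F \<subseteq> {v. TT R v = 0}" using R(2) by (intro M.span_minimal) auto
  with R(1) F(3) show ?thesis by (intro that[of R]) auto
qed

lemma T_pow_coeff_act: "primary L c u \<Longrightarrow> (T ^^ i) (coeff_act u k m) = coeff_act u k ((T ^^ i) m)"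
  by (induction i) (simp_all add: T_coeff_act)

text \<open>The submodules generated by m, Tm, ..., T^i m stabilize, so \<open>m\<close> satisfies a
  polynomial relation in \<open>T\<close> whose coefficients \<open>c i\<close> are polynomials in
  \<partial>.\<close>

lemma T_relation:
  obtains n c where "(\<Sum>i\<le>n::nat. mscale (c i) ((T ^^ i) m)) = 0" "c n \<noteq> 0"
proof -
  obtain S where S: "finite S" "M.span S = UNIV" by (rule finitely_generated)
  obtain n where n: "\<And>i. M.span ((\<lambda>i. (T ^^ i) m) ` {..i}) \<subseteq> M.span ((\<lambda>i. (T ^^ i) m) ` {..n})"
    using ascending_chain_stabilizes[OF M.module_axioms S, of "\<lambda>n. M.span ((\<lambda>i. (T ^^ i) m) ` {..n})"]
    by (metis (mono_tags) M.span_mono M.subspace_span atMost_subset_iff image_mono)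
  have "(T ^^ Suc n) m \<in> M.span ((\<lambda>i. (T ^^ i) m) ` {..n})"
    by (rule subsetD[OF n[of "Suc n"]], rule M.span_base, rule imageI) simp
  then obtain c where "(T ^^ Suc n) m = (\<Sum>i\<le>n. mscale (c i) ((T ^^ i) m))"
    using M.span_image_atMost by blast
  then have "(\<Sum>i\<le>Suc n. mscale ((c(Suc n := - 1)) i) ((T ^^ i) m)) = 0" by simp
  then show ?thesis using that[of "c(Suc n := - 1)" "Suc n"] by simp
qed

text \<open>A relation \<open>q(\<partial>,T) m = 0\<close> becomes \<open>q(\<partial>+\<lambda>,T) u\<^sub>\<lambda> m = 0\<close>; its leading coefficient in \<open>\<lambda>\<close> does
  not involve \<open>\<partial>\<close>.\<close>

lemma coeff_act_in_K:
  assumes u: "primary L c u"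
  shows "coeff_act u k m \<in> K"
proof -
  obtain n q where q: "(\<Sum>i\<le>n. mscale (q i) ((T ^^ i) m)) = 0" "q n \<noteq> 0"
    by (rule T_relation)
  \<comment> \<open>The highest \<partial>-degree in the relation. \<open>R\<close> below collects
    the coefficients of \<partial>^s; it is the leading coefficient in \<lambda> of
    q(\<partial>+\<lambda>,T).\<close>
  define s where "s = Max ((degree \<circ> q) ` {i. i \<le> n \<and> q i \<noteq> 0})"
  have "s \<in> (degree \<circ> q) ` {i. i \<le> n \<and> q i \<noteq> 0}"
    unfolding s_def using q(2) by (intro Max_in) auto
  then obtain i0 where i0: "i0 \<le> n" "q i0 \<noteq> 0" "s = degree (q i0)" by auto
  have s: "degree (q i) \<le> s" if "i \<le> n" for i
  proof (cases "q i = 0")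
    case False
    then show ?thesis unfolding s_def using that by (intro Max_ge) auto
  qed simp
  define R where "R = (\<Sum>i\<le>n. monom (coeff (q i) s) i)"
  have "coeff R i0 \<noteq> 0" using i0 by (simp add: R_def coeff_sum)
  then have "R \<noteq> 0" by auto
  have top: "TT R (coeff_act u b m) = 0"
    if rel: "(\<Sum>i\<le>n. mscale (q i) ((T ^^ i) m)) = 0" and b: "\<And>i. i > b \<Longrightarrow> coeff_act u i m = 0" for b m
  proof -
    have "0 = coeff_act u (b + s) (\<Sum>i\<le>n. mscale (q i) ((T ^^ i) m))"
      by (simp add: rel u.zero)
    also have "\<dots> = (\<Sum>i\<le>n. cmscale (coeff (q i) s) (coeff_act u b ((T ^^ i) m)))"
      unfolding u.sum
    proof (intro sum.cong refl coeff_act_mscale_top)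
      fix i j assume "b < j"
      then have "coeff_act u j ((T ^^ i) m) = (T ^^ i) 0" using b by (simp flip: T_pow_coeff_act[OF u])
      also have "\<dots> = 0" by (induction i) (simp_all add: T.zero)
      finally show "coeff_act u j ((T ^^ i) m) = 0" .
    qed (use s in auto)
    also have "\<dots> = TT R (coeff_act u b m)"
      by (simp add: R_def MC.poly_op_sum_monom linear_T T_pow_coeff_act[OF u])
    finally show ?thesis by simp
  qed
  \<comment> \<open>Induction on a bound \<open>b\<close> for the number of coefficients of
    u_\<lambda> m: R(T) m satisfies the same relation and, by \<open>top\<close>, loses the highest
    coefficient.\<close>
  have "TT (R ^ b) (coeff_act u k m) = 0"
    if "(\<Sum>i\<le>n. mscale (q i) ((T ^^ i) m)) = 0" "\<And>i. i \<ge> b \<Longrightarrow> coeff_act u i m = 0" for b k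
    using that
  proof (induction b arbitrary: m)
    case 0
    then show ?case by (simp add: TT.zero)
  next
    case (Suc b)
    have T_pow_TT: "(T ^^ i) (TT R m) = TT R ((T ^^ i) m)" for i
      by (induction i) (simp_all add: TT_commutes)
    have "TT (R ^ b) (coeff_act u k (TT R m)) = 0"
    proof (rule Suc.IH)
      have "(\<Sum>i\<le>n. mscale (q i) ((T ^^ i) (TT R m))) = TT R (\<Sum>i\<le>n. mscale (q i) ((T ^^ i) m))"
        by (simp add: T_pow_TT TT.sum TT_commutes)
      then show "(\<Sum>i\<le>n. mscale (q i) ((T ^^ i) (TT R m))) = 0"
        using Suc.prems(1) by (simp add: TT.zero)
      show "coeff_act u i (TT R m) = 0" if "b \<le> i" for i
        using top[OF Suc.prems(1), of b] Suc.prems(2) that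
        by (cases "i = b") (simp_all add: TT.zero flip: TT_commutes(5)[OF u])
    qed
    then show ?case
      by (simp add: MC.poly_op_mult linear_T power_Suc2 TT_commutes(5)[OF u] del: power_Suc)
  qed
  moreover have "coeff_act u i m = 0" if "i \<ge> Suc (degree (act u m))" for i
    using that by (simp add: coeff_act_def coeff_eq_0)
  ultimately have "TT (R ^ Suc (degree (act u m))) (coeff_act u k m) = 0" using q(1) by blast
  then show ?thesis unfolding K_def using \<open>R \<noteq> 0\<close> by (intro CollectI exI conjI) auto
qed

text \<open>As T = P - \<partial> and \<open>P\<close> commutes with \<partial>, the operators R(T)
  and R(-\<partial>) agree modulo PA.\<close>

lemma TT_mod_P:
  assumes A: "M.subspace A" "\<And>v. v \<in> A \<Longrightarrow> P v \<in> A" "v \<in> A"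
  shows "\<exists>y\<in>A. TT R v = mscale (R \<circ>\<^sub>p [:0, -1:]) v + P y"
proof (induction R)
  case 0
  then show ?case using M.subspace_0[OF A(1)] by (intro bexI[of _ 0]) (simp_all add: P.zero)
next
  case (pCons c R)
  then obtain y where y: "y \<in> A" "TT R v = mscale (R \<circ>\<^sub>p [:0, -1:]) v + P y" by blast
  have "T w \<in> A" if "w \<in> A" for w
    unfolding T_def using that by (intro M.subspace_diff M.subspace_scale A)
  then have "TT R v \<in> A"
    by (intro MC.poly_op_closed[OF linear_T _ _ A(3)] MC.subspaceI M.subspace_0[OF A(1)]
        M.subspace_add[OF A(1)] M.subspace_scale[OF A(1)])
  moreover have "mscale (pCons c R \<circ>\<^sub>p [:0, -1:]) v = cmscale c v - dee (mscale (R \<circ>\<^sub>p [:0, -1:]) v)"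
    by (simp add: pcompose_pCons flip: M.scale_left_diff_distrib)
  then have "TT (pCons c R) v = mscale (pCons c R \<circ>\<^sub>p [:0, -1:]) v + P (TT R v - dee y)"
    using coeff_act_dee(1)[of L y] y(2) arg_cong[OF y(2), of dee]
    by (simp add: MC.poly_op_pCons linear_T T_def P.diff dee.add del: M.scale_scale)
  ultimately show ?case
    using y(1) A by (intro bexI[of _ "TT R v - dee y"] M.subspace_diff M.subspace_scale)
qed

section \<open>The filtration of K by the submodules P^j K\<close>

definition K_filt :: "nat \<Rightarrow> 'm set" where "K_filt j = (P ^^ j) ` K"

lemma P_pow_Suc: "(P ^^ Suc j) v = (P ^^ j) (P v)"
  by (simp add: funpow_swap1)

lemma P_pow_mscale: "(P ^^ j) (mscale p v) = mscale p ((P ^^ j) v)"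
proof -
  have "P (mscale p v) = mscale p (P v)" for v
  proof (induction p)
    case (pCons c p)
    then show ?case
      by (simp add: mscale_pCons[of c p] P.add P.scale coeff_act_dee del: M.scale_scale)
  qed (simp add: P.zero)
  then show ?thesis by (induction j) simp_all
qed

lemma P_pow_add: "(P ^^ j) (v + w) = (P ^^ j) v + (P ^^ j) w"
  by (induction j) (simp_all add: P.add)

lemma P_pow_0: "(P ^^ j) 0 = 0"
  by (induction j) (simp_all add: P.zero)

lemma linear_P_pow: "Vector_Spaces.linear cmscale cmscale (P ^^ j)"
  by unfold_locales (simp_all only: P_pow_add P_pow_mscale)

lemma P_pow_H: "H ((P ^^ j) v) = (P ^^ j) (H v) + cmscale (of_nat j) ((P ^^ j) v)"
proof (induction j)
  case (Suc j)
  then show ?case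
    by (simp add: H_P P.add P.scale MC.scale_left_distrib[of 1, simplified] flip: one_pCons)
qed simp

lemma subspace_K_filt: "M.subspace (K_filt j)"
proof (rule M.subspaceI)
  show "0 \<in> K_filt j"
    unfolding K_filt_def using M.subspace_0[OF subspace_K] P_pow_0 by (metis image_eqI)
  show "v + w \<in> K_filt j" if "v \<in> K_filt j" "w \<in> K_filt j" for v w
    using that M.subspace_add[OF subspace_K] by (auto simp: K_filt_def simp flip: P_pow_add)
  show "mscale p v \<in> K_filt j" if "v \<in> K_filt j" for p v
    using that M.subspace_scale[OF subspace_K] by (auto simp: K_filt_def simp flip: P_pow_mscale)
qed

lemma MC_subspace: "M.subspace A \<Longrightarrow> MC.subspace A"
  by (simp add: M.subspace_def MC.subspace_def)

lemma K_filt_antimono: "i \<le> j \<Longrightarrow> K_filt j \<subseteq> K_filt i"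
proof (induction rule: dec_induct)
  case (step n)
  have "K_filt (Suc n) \<subseteq> K_filt n"
    unfolding K_filt_def using K_closeds(1) by (auto simp: P_pow_Suc simp del: funpow.simps)
  with step show ?case by blast
qed simp

lemma P_K_filt: "v \<in> K_filt j \<Longrightarrow> P v \<in> K_filt (Suc j)"
  unfolding K_filt_def by auto

lemma H_K_filt: "v \<in> K_filt j \<Longrightarrow> H v \<in> K_filt j"
proof -
  assume "v \<in> K_filt j"
  then obtain w where w: "w \<in> K" "v = (P ^^ j) w" by (auto simp: K_filt_def)
  have "H v = (P ^^ j) (H w + cmscale (of_nat j) w)"
    by (simp add: w P_pow_H P_pow_add P_pow_mscale)
  moreover have "H w + cmscale (of_nat j) w \<in> K"
    using w(1) by (intro M.subspace_add[OF subspace_K] K_closeds)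
  ultimately show ?thesis by (auto simp: K_filt_def)
qed

text \<open>R(T) = 0 on \<open>K\<close> puts R(-\<partial>)K inside PK, so K/PK is finitely
  generated torsion, hence finite dimensional. P^j maps it onto P^j K / P^(j+1) K.\<close>

lemma finite_codim_K_filt: "finite_codim cmscale K (K_filt j)"
proof (induction j)
  case 0
  then show ?case by (simp add: K_filt_def MC.finite_codim_refl)
next
  case (Suc j)
  obtain R where R: "R \<noteq> 0" "\<And>v. v \<in> K \<Longrightarrow> TT R v = 0" using K_annihilator by blast
  obtain F where F: "finite F" "F \<subseteq> K" "K = M.span F" by (rule finitely_generated_K)
  have R0: "R \<circ>\<^sub>p [:0, -1:] \<noteq> 0" using R(1) by (simp add: pcompose_uminus_eq_0)
  have "finite_codim cmscale K (K_filt 1)"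
  proof (rule finite_codim_of_torsion[OF F(1,3) subspace_K_filt R0])
    fix v assume v: "v \<in> K"
    then obtain y where y: "y \<in> K" "TT R v = mscale (R \<circ>\<^sub>p [:0, -1:]) v + P y"
      using TT_mod_P[OF subspace_K K_closeds(1) v] by blast
    then have "mscale (R \<circ>\<^sub>p [:0, -1:]) v = P (- y)"
      using R(2)[OF v] by (simp add: P.neg eq_neg_iff_add_eq_0)
    moreover have "- y \<in> K" using y(1) by (rule M.subspace_neg[OF subspace_K])
    ultimately show "mscale (R \<circ>\<^sub>p [:0, -1:]) v \<in> K_filt 1" by (auto simp: K_filt_def)
  qed
  then have "finite_codim cmscale (K_filt j) ((P ^^ j) ` K_filt 1)"
    unfolding K_filt_def[of j] by (rule MC.finite_codim_image[OF linear_P_pow])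
  also have "(P ^^ j) ` K_filt 1 = K_filt (Suc j)"
    by (simp add: K_filt_def image_image P_pow_Suc del: funpow.simps)
  finally have "finite_codim cmscale (K_filt j) (K_filt (Suc j))" .
  moreover have "K_filt j \<subseteq> K"
    using K_filt_antimono[of 0 j] by (simp add: K_filt_def)
  ultimately show ?case by (rule MC.finite_codim_trans[OF Suc])
qed

text \<open>Krull's intersection theorem for \<open>K\<close>: \<open>P\<close> is bijective on the intersection, and on an eigenspace
  of \<open>T\<close> it is multiplication by \<open>\<partial> + \<alpha>\<close>. Bijectivity then produces a torsion element, on which \<open>L\<close>,
  hence \<open>P\<close>, is zero.\<close>

lemma K_filt_INT:
  assumes "\<And>j. z \<in> K_filt j"
  shows "z = 0"
proof (rule ccontr)
  assume "z \<noteq> 0"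
  define Z where "Z = (\<Inter>j. K_filt j)"
  have Z: "M.subspace Z" unfolding Z_def by (rule M.subspace_Inter) (auto intro: subspace_K_filt)
  obtain S where S: "finite S" "M.span S = UNIV" by (rule finitely_generated)
  \<comment> \<open>The kernels of P^i on \<open>K\<close> stabilize at \<open>n\<close>, which
    makes \<open>P\<close> injective on P^n K.\<close>
  obtain n where n: "\<And>i. {v \<in> K. (P ^^ i) v = 0} \<subseteq> {v \<in> K. (P ^^ n) v = 0}"
  proof (rule ascending_chain_stabilizes[OF M.module_axioms S, of "\<lambda>i. {v \<in> K. (P ^^ i) v = 0}"])
    show "M.subspace {v \<in> K. (P ^^ i) v = 0}" for i
      by (rule M.subspaceI)
        (auto simp: P_pow_add P_pow_0 P_pow_mscale intro: M.subspace_0 M.subspace_add subspace_K K_closeds)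
    show "{v \<in> K. (P ^^ i) v = 0} \<subseteq> {v \<in> K. (P ^^ j) v = 0}" if "i \<le> j" for i j
    proof -
      have "(P ^^ j) v = (P ^^ (j - i)) ((P ^^ i) v)" for v
        using that by (simp flip: funpow_add[THEN fun_cong, unfolded o_def])
      then show ?thesis by (auto simp: P_pow_0)
    qed
  qed (rule that)
  have P_inj: "v = 0" if "v \<in> K_filt n" "P v = 0" for v
  proof -
    obtain w where "w \<in> K" "v = (P ^^ n) w" using \<open>v \<in> K_filt n\<close> by (auto simp: K_filt_def)
    then show ?thesis using n[of "Suc n"] \<open>P v = 0\<close> by auto
  qed
  have P_surj: "\<exists>w\<in>Z. P w = v" if v: "v \<in> Z" for v
  proof -
    have "\<exists>w\<in>K_filt j. P w = v" for j
    proof -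
      have "v \<in> K_filt (Suc j)" using v by (auto simp: Z_def)
      then show ?thesis by (auto simp: K_filt_def)
    qed
    \<comment> \<open>A preimage is chosen on every level; injectivity forces these to agree from
      level \<open>n\<close> on, so \<open>w n\<close> lies in all levels.\<close>
    then obtain w where w: "\<And>j. w j \<in> K_filt j" "\<And>j. P (w j) = v" by metis
    have stable: "w j = w n" if "j \<ge> n" for j
    proof -
      have "w j - w n \<in> K_filt n"
        using w(1) K_filt_antimono[OF that] by (intro M.subspace_diff[OF subspace_K_filt]) auto
      then have "w j - w n = 0" by (rule P_inj) (simp add: P.diff w(2))
      then show ?thesis by simp
    qed
    have "w n \<in> K_filt j" for j
      using w(1)[of "max j n"] K_filt_antimono[of j "max j n"] stable[of "max j n"] by auto
    then show ?thesis using w(2) unfolding Z_def by blast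
  qed
  have "Z \<subseteq> K_filt 0" by (auto simp: Z_def)
  then have Z_K: "Z \<subseteq> K" by (simp add: K_filt_def)
  have P_Z: "P v \<in> Z" if "v \<in> Z" for v
  proof -
    have "P v \<in> K_filt j" for j
      using P_K_filt[of v j] that K_filt_antimono[of j "Suc j"] by (auto simp: Z_def)
    then show ?thesis by (simp add: Z_def)
  qed
  have T_Z: "T v \<in> Z" if "v \<in> Z" for v
    unfolding T_def using that P_Z Z by (intro M.subspace_diff M.subspace_scale)
  have "z \<in> Z" using assms by (auto simp: Z_def)
  then obtain R where R: "R \<noteq> 0" "TT R z = 0" using Z_K by (auto simp: K_def)
  obtain \<alpha> z0 where z0: "z0 \<in> Z" "z0 \<noteq> 0" "T z0 = cmscale \<alpha> z0"
  proof (rule MC.annihilated_eigenvector[OF _ linear_T MC_subspace[OF Z] T_Z R \<open>z \<in> Z\<close> \<open>z \<noteq> 0\<close>])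
    show "\<exists>z. poly p z = 0" if "degree p > 0" for p :: "complex poly"
      using that fundamental_theorem_of_algebra[of p] by (auto simp: constant_degree)
  qed
  define E where "E = {v \<in> Z. T v = cmscale \<alpha> v}"
  \<comment> \<open>A preimage \<open>w\<close> in \<open>Z\<close> of an eigenvector is an
    eigenvector again: Tw - \<alpha>w lies in \<open>Z\<close> and is killed by
    \<open>P\<close>.\<close>
  have "\<exists>w\<in>E. P w = v" if v: "v \<in> E" for v
  proof -
    obtain w where w: "w \<in> Z" "P w = v" using P_surj v by (auto simp: E_def)
    have "P (T w - cmscale \<alpha> w) = 0"
      using v by (simp add: P.diff P.scale w E_def flip: T_P)
    moreover have "T w - cmscale \<alpha> w \<in> Z"
      using w T_Z Z by (intro M.subspace_diff M.subspace_scale)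
    ultimately have "T w - cmscale \<alpha> w = 0" using P_inj unfolding Z_def by blast
    then show ?thesis using w by (auto simp: E_def)
  qed
  then obtain pre where pre: "\<And>v. v \<in> E \<Longrightarrow> pre v \<in> E" "\<And>v. v \<in> E \<Longrightarrow> P (pre v) = v" by metis
  \<comment> \<open>Iterated preimages of \<open>z0\<close>. On \<open>E\<close> the operator
    \<open>P\<close> is \<partial> + \<alpha>, so each \<open>zs i\<close> is (\<partial> +
    \<alpha>) applied to the next one.\<close>
  define zs where "zs i = (pre ^^ i) z0" for i
  have "z0 \<in> E" using z0 by (simp add: E_def)
  then have zs_E: "zs i \<in> E" for i
    by (induction i) (simp_all add: zs_def pre(1))
  let ?\<pi> = "[:\<alpha>, 1:]"
  have step: "zs i = mscale ?\<pi> (zs (Suc i))" for i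
  proof -
    have "zs i = P (zs (Suc i))" using pre(2)[OF zs_E[of i]] by (simp add: zs_def)
    also have "\<dots> = T (zs (Suc i)) + dee (zs (Suc i))" by (simp add: T_def)
    also have "T (zs (Suc i)) = cmscale \<alpha> (zs (Suc i))" using zs_E by (auto simp: E_def)
    finally show ?thesis by (simp flip: M.scale_left_distrib)
  qed
  have steps: "zs i = mscale (?\<pi> ^ d) (zs (i + d))" for i d
  proof (induction d)
    case (Suc d)
    then show ?case using step[of "i + d"] by (simp only: M.scale_scale power_Suc2 add_Suc_right)
  qed simp
  obtain n where n: "\<And>i. M.span (zs ` {..i}) \<subseteq> M.span (zs ` {..n})"
    using ascending_chain_stabilizes[OF M.module_axioms S, of "\<lambda>n. M.span (zs ` {..n})"]
    by (metis (mono_tags) M.span_mono M.subspace_span atMost_subset_iff image_mono)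
  have "zs (Suc n) \<in> M.span (zs ` {..n})"
    by (rule subsetD[OF n[of "Suc n"]], rule M.span_base, rule imageI) simp
  then obtain c where "zs (Suc n) = (\<Sum>i\<le>n. mscale (c i) (zs i))"
    using M.span_image_atMost by blast
  also have "\<dots> = (\<Sum>i\<le>n. mscale (c i * ?\<pi> ^ (Suc n - i)) (zs (Suc n)))"
  proof (intro sum.cong refl)
    fix i assume "i \<in> {..n}"
    then show "mscale (c i) (zs i) = mscale (c i * ?\<pi> ^ (Suc n - i)) (zs (Suc n))"
      using steps[of i "Suc n - i"] by (simp flip: M.scale_scale)
  qed
  also have "\<dots> = mscale (\<Sum>i\<le>n. c i * ?\<pi> ^ (Suc n - i)) (zs (Suc n))"
    by (simp add: M.scale_sum_left)
  \<comment> \<open>The vectors \<open>zs i\<close> with i \<le> n are multiples of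
    \<open>zs (Suc n)\<close> by positive powers of \<partial> + \<alpha>. The resulting annihilator
    takes the value 1 at -\<alpha> and is thus nonzero.\<close>
  finally have "mscale (1 - (\<Sum>i\<le>n. c i * ?\<pi> ^ (Suc n - i))) (zs (Suc n)) = 0"
    by (simp add: M.scale_left_diff_distrib)
  moreover have "poly (1 - (\<Sum>i\<le>n. c i * ?\<pi> ^ (Suc n - i))) (- \<alpha>) = 1"
    by (auto simp: poly_sum poly_power intro!: sum.neutral)
  then have "1 - (\<Sum>i\<le>n. c i * ?\<pi> ^ (Suc n - i)) \<noteq> 0" by auto
  \<comment> \<open>The torsion vector \<open>zs (Suc n)\<close> is killed by \<open>P\<close>, but
    \<open>P\<close> maps it to \<open>zs n\<close>, of which \<open>z0\<close> is a
    multiple.\<close>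
  ultimately have "act L (zs (Suc n)) = 0" by (rule act_torsion)
  then have "zs n = 0"
    using pre(2)[OF zs_E[of n]] by (simp add: zs_def coeff_act_def)
  then show False using steps[of 0 n] z0(2) by (simp add: zs_def)
qed

text \<open>\<open>u\<^bsub>(k)\<^esub>\<close> shifts the eigenvalues of \<open>H\<close> by \<open>c - 1 - k\<close>, and \<open>P\<^sup>j\<close> shifts them by \<open>j\<close>. So once \<open>k + j\<close> is
  large, \<open>H\<close> has no eigenvalue in common on the generators and on \<open>P\<^sup>j K / P\<^bsup>j+1\<^esup> K\<close>.\<close>

lemma coeff_act_K_filt_step:
  assumes u: "primary L c u"
    and f: "\<And>m. coeff_act u k (poly_op cmscale H f m) \<in> K_filt (Suc j)"
    and g: "\<And>v. v \<in> K \<Longrightarrow> poly_op cmscale H g v \<in> K_filt 1"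
    and coprime: "\<And>x y. poly f x = 0 \<Longrightarrow> poly g y = 0 \<Longrightarrow> y - x \<noteq> c - 1 - of_nat (k + j)"
    and "coeff_act u k m \<in> K_filt j"
  shows "coeff_act u k m \<in> K_filt (Suc j)"
proof -
  let ?y = "coeff_act u k m" and ?b = "c - 1 - of_nat k"
  note HH = linear_coeff_act[of L "Suc 0"]
  \<comment> \<open>\<open>I\<close> is an ideal and the claim is that it contains 1. Its members
    obtained from \<open>f\<close> and \<open>g\<close> are shifted by \<open>?b\<close> and by j,
    and a common root would contradict \<open>coprime\<close>.\<close>
  define I where "I = {p. poly_op cmscale H p ?y \<in> K_filt (Suc j)}"
  have shift: "p \<circ>\<^sub>p [:- a, 1:] \<circ>\<^sub>p [:a, 1:] = p" for p :: "complex poly" and a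
    by (simp add: pcompose_assoc [symmetric] pcompose_pCons)
  have "1 \<in> I"
  proof (rule complex_poly_ideal_unit)
    show "p + q \<in> I" if "p \<in> I" "q \<in> I" for p q
      using that M.subspace_add[OF subspace_K_filt] by (simp add: I_def MC.poly_op_add HH)
    show "p * q \<in> I" if "q \<in> I" for p q
      using that MC.poly_op_closed[OF HH MC_subspace[OF subspace_K_filt] H_K_filt]
      by (simp add: I_def MC.poly_op_mult HH)
    have "poly_op cmscale H (f \<circ>\<^sub>p [:- ?b, 1:]) ?y = coeff_act u k (poly_op cmscale H f m)"
      using MC.poly_op_shift[OF HH linear_coeff_act H_coeff_act[OF u], of "f \<circ>\<^sub>p [:- ?b, 1:]" k m] shift
      by metis
    then show "f \<circ>\<^sub>p [:- ?b, 1:] \<in> I" using f by (simp add: I_def)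
    obtain z where z: "z \<in> K" "?y = (P ^^ j) z" using assms(5) by (auto simp: K_filt_def)
    have "poly_op cmscale H (g \<circ>\<^sub>p [:- of_nat j, 1:]) ?y = (P ^^ j) (poly_op cmscale H g z)"
      using MC.poly_op_shift[OF HH linear_P_pow P_pow_H, of "g \<circ>\<^sub>p [:- of_nat j, 1:]" j z] shift z(2)
      by metis
    moreover obtain z' where "z' \<in> K" "poly_op cmscale H g z = P z'"
      using g[OF z(1)] by (auto simp: K_filt_def)
    ultimately show "g \<circ>\<^sub>p [:- of_nat j, 1:] \<in> I"
      by (auto simp: I_def K_filt_def P_pow_Suc simp del: funpow.simps)
    fix z assume "poly (f \<circ>\<^sub>p [:- ?b, 1:]) z = 0" "poly (g \<circ>\<^sub>p [:- of_nat j, 1:]) z = 0"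
    then show False
      using coprime[of "z - ?b" "z - of_nat j"] by (simp add: poly_pcompose algebra_simps)
  qed
  then show ?thesis by (simp add: I_def MC.poly_op_1 HH)
qed

section \<open>Finite dimension of the space of primary elements\<close>

theorem finite_dim_primary:
  assumes "faithful_conformal act"
  shows "\<exists>G. finite G \<and> {u. primary L c u} \<subseteq> C.span G"
proof -
  note HH = linear_coeff_act[of L "Suc 0"]
  obtain R where R: "R \<noteq> 0" "\<And>v. v \<in> K \<Longrightarrow> TT R v = 0" using K_annihilator by blast
  \<comment> \<open>On \<open>V\<close> the components u_k are controlled by u_k R(T) = R(T) u_k = 0
    and u_k P = P u_k + u_(k-1). Only a finite complement \<open>F\<close> is left for explicit
    conditions.\<close>
  define V where "V = {P v + TT R w | v w. True}"
  have V: "M.subspace V"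
  proof (rule M.subspaceI)
    show "0 \<in> V" unfolding V_def using P.zero TT.zero by (metis (mono_tags, lifting) add_0 mem_Collect_eq)
    show "x + y \<in> V" if xy: "x \<in> V" "y \<in> V" for x y
    proof -
      from xy obtain v w v' w' where "x = P v + TT R w" "y = P v' + TT R w'" by (auto simp: V_def)
      then have "x + y = P (v + v') + TT R (w + w')" by (simp add: P.add TT.add)
      then show ?thesis unfolding V_def by blast
    qed
    show "mscale p x \<in> V" if x: "x \<in> V" for p x
    proof -
      from x obtain v w where "x = P v + TT R w" by (auto simp: V_def)
      then have "mscale p x = P (mscale p v) + TT R (mscale p w)"
        using P_pow_mscale[of 1 p v] by (simp add: TT_commutes M.scale_right_distrib)
      then show ?thesis unfolding V_def by blast
    qed
  qed
  obtain S where S: "finite S" "M.span S = UNIV" by (rule finitely_generated)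
  have R0: "R \<circ>\<^sub>p [:0, -1:] \<noteq> 0" using R(1) by (simp add: pcompose_uminus_eq_0)
  have "finite_codim cmscale UNIV V"
  proof (rule finite_codim_of_torsion[OF S(1) S(2)[symmetric] V R0])
    fix v
    obtain y where "TT R v = mscale (R \<circ>\<^sub>p [:0, -1:]) v + P y"
      using TT_mod_P[of UNIV v R] by auto
    then have "mscale (R \<circ>\<^sub>p [:0, -1:]) v = P (- y) + TT R v" by (simp add: P.neg)
    then show "mscale (R \<circ>\<^sub>p [:0, -1:]) v \<in> V" unfolding V_def by blast
  qed
  then obtain F where F: "finite F" "UNIV \<subseteq> MC.span (F \<union> V)" by (auto simp: finite_codim_def)
  have H_V: "H x \<in> V" if "x \<in> V" for x
  proof -
    from that obtain v w where "x = P v + TT R w" by (auto simp: V_def)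
    then have "H x = P (H v + v) + TT R (H w)"
      by (simp add: H.add H_P P.add TT_commutes)
    then show ?thesis unfolding V_def by blast
  qed
  \<comment> \<open>\<open>H\<close> acts on the finite dimensional spaces M/V and K/PK; the roots
    of \<open>f\<close> and \<open>g\<close> contain its eigenvalues there.\<close>
  obtain f where f: "f \<noteq> 0" "\<And>v. poly_op cmscale H f v \<in> V"
    using MC.finite_codim_annihilator[OF HH MC.subspace_UNIV _ MC_subspace[OF V] H_V]
      \<open>finite_codim cmscale UNIV V\<close> by (metis UNIV_I)
  obtain g where g: "g \<noteq> 0" "\<And>v. v \<in> K \<Longrightarrow> poly_op cmscale H g v \<in> K_filt 1"
    using MC.finite_codim_annihilator[OF HH MC_subspace[OF subspace_K] K_closeds(2)
        MC_subspace[OF subspace_K_filt] H_K_filt finite_codim_K_filt] by metis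
  define X where "X = (\<lambda>(x, y). y - x) ` ({x. poly f x = 0} \<times> {y. poly g y = 0})"
  have "finite X" unfolding X_def using f(1) g(1) by (auto intro!: poly_roots_finite)
  then have "finite ((\<lambda>n. c - 1 - of_nat n :: complex) -` X)"
    by (rule finite_vimageI) (auto simp: inj_def)
  \<comment> \<open>From n = B on, the shift c - 1 - n is not a root of \<open>g\<close> minus a
    root of \<open>f\<close>.\<close>
  then obtain B where B: "\<And>n. c - 1 - of_nat n \<in> X \<Longrightarrow> n < B"
    by (auto simp: finite_nat_set_iff_bounded)
  let ?I = "{..B} \<times> F"
  \<comment> \<open>The conditions place u_k e, for e in \<open>F\<close>, in P^(B-k) K. At k = B
    they hold for every primary u, since P^0 K = K.\<close>
  let ?E = "{u \<in> {u. primary L c u}. \<forall>i\<in>?I. coeff_act u (fst i) (snd i) \<in> K_filt (B - fst i)}"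
  interpret pair: vector_space_pair cscale cmscale ..
  have "C.subspace {u. primary L c u}"
  proof (rule C.subspaceI)
    have "lbracket L 0 = 0" using lbracket_add_right[of L 0 0] by simp
    then show "0 \<in> {u. primary L c u}" by (simp add: primary_def)
    show "x + y \<in> {u. primary L c u}" if "x \<in> {u. primary L c u}" "y \<in> {u. primary L c u}" for x y
      using that by (simp add: primary_def lbracket_add_right scale_right_distrib)
    show "cscale a x \<in> {u. primary L c u}" if "x \<in> {u. primary L c u}" for a x
      using that by (simp add: primary_def lbracket_scale_right map_poly_pCons mult.commute)
  qed
  then have codim: "finite_codim cscale {u. primary L c u} ?E"
    by (intro pair.finite_codim_INT_vimage[where A = "\<lambda>_. K"])
      (auto simp: F(1) linear_coeff_act_left MC_subspace subspace_K_filt finite_codim_K_filt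
        intro: coeff_act_in_K)
  have "u = 0" if u: "primary L c u" and uE: "\<And>k e. k \<le> B \<Longrightarrow> e \<in> F \<Longrightarrow> coeff_act u k e \<in> K_filt (B - k)" for u
  proof -
    \<comment> \<open>Outer induction on k, inner induction on j: raising j for u_k uses u_(k-1) on
      every level.\<close>
    have "\<forall>m. coeff_act u k m \<in> K_filt j" for k j
    proof (induction k arbitrary: j)
      have V_step: "coeff_act u k x \<in> K_filt (Suc j)"
        if k: "k = 0 \<or> (\<exists>k'. k = Suc k' \<and> (\<forall>m. coeff_act u k' m \<in> K_filt (Suc j)))"
          and j: "\<forall>m. coeff_act u k m \<in> K_filt j" and x: "x \<in> V" for k j x
      proof -
        obtain v w where x: "x = P v + TT R w" using x by (auto simp: V_def)
        have "coeff_act u k (TT R w) = 0"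
          using R(2)[OF coeff_act_in_K[OF u]] by (simp flip: TT_commutes(5)[OF u])
        moreover have "coeff_act u k (P v) \<in> K_filt (Suc j)"
          using k j P_K_filt P_coeff_act[OF u] M.subspace_add[OF subspace_K_filt]
          by (metis (no_types))
        ultimately show ?thesis by (simp add: x u.add)
      qed
      have main: "\<forall>m. coeff_act u k m \<in> K_filt j"
        if k: "k = 0 \<or> (\<exists>k'. k = Suc k' \<and> (\<forall>m j. coeff_act u k' m \<in> K_filt j))" for k j
      proof (induction j)
        case 0
        show ?case using coeff_act_in_K[OF u] by (simp add: K_filt_def)
      next
        case (Suc j)
        have V_step': "coeff_act u k x \<in> K_filt (Suc j)" if "x \<in> V" for x
          using V_step[OF _ Suc that] k by blast
        show ?case
        \<comment> \<open>Below \<open>B\<close> the conditions of \<open>?E\<close> settle the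
          values on \<open>F\<close>; from \<open>B\<close> on the relevant spectra of
          \<open>H\<close> are disjoint.\<close>
        proof (cases "k + j < B")
          case True
          then have "Suc j \<le> B - k" by simp
          then have "F \<union> V \<subseteq> coeff_act u k -` K_filt (Suc j)"
            using V_step' uE[of k] K_filt_antimono[of "Suc j" "B - k"] True by auto
          then have "MC.span (F \<union> V) \<subseteq> coeff_act u k -` K_filt (Suc j)"
            by (intro MC.span_minimal u.subspace_vimage MC_subspace subspace_K_filt)
          then show ?thesis using F(2) by blast
        next
          case False
          show ?thesis
          proof
            fix m
            show "coeff_act u k m \<in> K_filt (Suc j)"
            proof (rule coeff_act_K_filt_step[OF u _ g(2)])
              show "coeff_act u k (poly_op cmscale H f m) \<in> K_filt (Suc j)" for m
                using V_step' f(2) by blast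
              show "y - x \<noteq> c - 1 - of_nat (k + j)" if "poly f x = 0" "poly g y = 0" for x y
              proof -
                have "(\<lambda>(x, y). y - x) (x, y) \<in> X" unfolding X_def using that by blast
                then show ?thesis using B[of "k + j"] False by auto
              qed
            qed (use Suc in auto)
          qed
        qed
      qed
      case 0
      show ?case by (rule main) simp
      case (Suc k)
      then show ?case by (intro main) simp
    qed
    then have "coeff_act u k m = 0" for k m by (intro K_filt_INT) blast
    then have "act u m = 0" for m by (simp add: coeff_act_def poly_eq_iff)
    then show ?thesis using assms by (simp add: faithful_conformal_def)
  qed
  then have "?E \<subseteq> {0}" by auto
  obtain G where G: "finite G" "{u. primary L c u} \<subseteq> C.span (G \<union> ?E)"
    using codim by (auto simp: finite_codim_def)
  have "C.span (G \<union> ?E) \<subseteq> C.span (insert 0 G)"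
    using \<open>?E \<subseteq> {0}\<close> by (intro C.span_mono) blast
  with G show ?thesis by (intro exI[of _ "insert 0 G"]) blast
qed

end


section \<open>The contradiction for an infinite dimensional Lie algebra g\<close>

theorem proposition3p6:
  fixes scale :: "complex \<Rightarrow> 'g::ab_group_add \<Rightarrow> 'g"
    and bracket :: "'g \<Rightarrow> 'g \<Rightarrow> 'g"
    and a :: complex
  assumes "lie_algebra scale bracket"
    and "\<not> (\<exists>B. finite_dimensional_vector_space scale B)"
    and "\<not> lie_abelian bracket \<longrightarrow> a = 1"
  shows "\<not> (\<exists>(mscale :: complex poly \<Rightarrow> 'm::ab_group_add \<Rightarrow> 'm) act.
           conformal_module (vir_cur_scale scale) (vir_cur_bracket scale bracket a) mscale act \<and>
           finite_conformal mscale \<and> faithful_conformal act)"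
proof
  assume "\<exists>(mscale :: complex poly \<Rightarrow> 'm::ab_group_add \<Rightarrow> 'm) act.
           conformal_module (vir_cur_scale scale) (vir_cur_bracket scale bracket a) mscale act \<and>
           finite_conformal mscale \<and> faithful_conformal act"
  then obtain mscale :: "complex poly \<Rightarrow> 'm \<Rightarrow> 'm" and act
    where M: "conformal_module (vir_cur_scale scale) (vir_cur_bracket scale bracket a) mscale act"
      and fin: "finite_conformal mscale" and faithful: "faithful_conformal act"
    by blast
  interpret g: lie_algebra scale bracket by fact
  interpret CM: conformal_module "vir_cur_scale scale" "vir_cur_bracket scale bracket a" mscale act by fact
  \<comment> \<open>Elements of g have weight \<open>a\<close>, so the finite dimensional space of
    primary elements of weight \<open>a\<close> contains the image of \<open>cur\<close>.\<close>
  have primary_cur: "CM.primary vir_L a (cur x)" for x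
    unfolding CM.primary_def g.br_L_x g.scale_deriv g.scale_const
    by (simp add: cur_def map_poly_pCons)
  interpret V: finite_virasoro_module "vir_cur_scale scale" "vir_cur_bracket scale bracket a" mscale act vir_L
  proof
    show "CM.primary vir_L 2 vir_L"
      unfolding CM.primary_def g.br_L_L g.scale_deriv g.scale_const
      by (simp add: vir_L_def map_poly_pCons)
  qed (rule fin)
  obtain G where G: "finite G" "{u. CM.primary vir_L a u} \<subseteq> CM.C.span G"
    using V.finite_dim_primary[OF faithful] by blast
  interpret pair: vector_space_pair scale "\<lambda>c. vir_cur_scale scale [:c:]" ..
  have lin: "Vector_Spaces.linear scale (\<lambda>c. vir_cur_scale scale [:c:]) cur"
    by unfold_locales (simp_all add: cur_def g.scale_const map_poly_pCons)
  have "inj cur" by (simp add: inj_def cur_def)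
  \<comment> \<open>By injectivity of \<open>cur\<close> the preimage of 0 is zero, and its finite
    codimension is finite dimension of g.\<close>
  have "finite_codim scale UNIV (UNIV \<inter> cur -` {0 :: 'g vir_cur})"
    by (rule pair.finite_codim_vimage[OF lin _ CM.C.subspace_single_0 G(1)])
      (use G(2) primary_cur CM.C.span_mono[of G "G \<union> {0}"] in auto)
  moreover have "UNIV \<inter> cur -` {0 :: 'g vir_cur} = {0}" by (auto simp: cur_def zero_prod_def)
  ultimately obtain F where F: "finite F" "UNIV \<subseteq> g.span (F \<union> {0})"
    by (auto simp: finite_codim_def)
  \<comment> \<open>The locale asks for a basis, so the finite spanning set is thinned to an
    independent one.\<close>
  obtain B where B: "B \<subseteq> F \<union> {0}" "g.independent B" "F \<union> {0} \<subseteq> g.span B"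
    by (rule g.maximal_independent_subset)
  have "finite_dimensional_vector_space scale B"
  proof
    show "finite B" using B(1) F(1) finite_subset by blast
    show "g.span B = UNIV" using F(2) g.span_minimal[OF B(3) g.subspace_span] by blast
  qed (rule B(2))
  with assms(2) show False by blast
qed

end
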